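(* Let $d\ge 1$ be an integer, let $A,\bar A\in\mathbb R^{n\times n}$, $B,\bar B\in\mathbb R^{n\times m}$, let $Q\in\mathbb R^{n\times n}$ be symmetric with $Q\ge 0$ and $R\in\mathbb R^{m\times m}$ symmetric with $R>0$, and assume that $(A,\bar A\,|\,Q^{1/2})$ is exactly observable. Let $K_0\in\mathbb R^{m\times n}$ be stabilizing. For $j=0,1,2,\dots$ let $P_j^i$, $i=0,\dots,d$, be the positive definite solution of the Lyapunov-type equations $$P_j^{i-1}=A'P_j^{i}A+\bar A'P_j^0\bar A+Q,\qquad i=1,\dots,d,$$ $$P_j^d=(A-BK_j)'P_j^d(A-BK_j)+(\bar A-\bar BK_j)'P_j^0(\bar A-\bar BK_j)+K_j'RK_j+Q,$$ where, for $j=1,2,\dots$, $K_j$ is defined recursively by $$K_j=(R+B'P_{j-1}^dB+\bar B'P_{j-1}^0\bar B)^{-1}(B'P_{j-1}^dA+\bar B'P_{j-1}^0\bar A).$$ Then: 1) for every $j$, $K_j$ is stabilizing, i.e. the system $x_{k+1}=(A+w_k\bar A)x_k+(B+w_k\bar B)u_{k-d}$ is stabilized by $u_{k-d}=-K_j\,x_k|_{k-d-1}$; 2) $0<P_{j+1}^i\le P_j^i$ for all $i=0,\dots,d$ and all $j\ge 0$; 3) the limits $\lim_{j\to\infty}P_j^i=P^i$, $i=0,\dots,d$, and $\lim_{j\to\infty}K_j=K$ exist, and they satisfy $$P^{i-1}=A'P^{i}A+\bar A'P^0\bar A+Q,\qquad i=1,\dots,d,$$ $$P^d=(A-BK)'P^d(A-BK)+(\bar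 A-\bar BK)'P^0(\bar A-\bar BK)+K'RK+Q,$$ $$K=(R+B'P^dB+\bar B'P^0\bar B)^{-1}(B'P^dA+\bar B'P^0\bar A).$$
   Context: Notation. A prime denotes transpose; $M>0$ ($M\ge0$) means symmetric positive definite (semi-definite); $M\le N$ means $N-M\ge0$. $\{w_k\}_{k\ge0}$ is a scalar white-noise sequence (independent random variables) with zero mean and $\mathsf E[w_kw_s]=\delta_{ks}$; $\mathcal F_k=\sigma(w_0,\dots,w_k)$ for $k\ge 0$, and $\mathcal F_k$ is trivial for $k<0$. $x_k|_m=\mathsf E[x_k\mid\mathcal F_m]$. Write $A_k=A+w_k\bar A$, $B_k=B+w_k\bar B$. System. $x_{k+1}=A_kx_k+B_ku_{k-d}$, $k\ge0$, with state $x_k\in\mathbb R^n$, input $u_k\in\mathbb R^m$, and deterministic initial data $x_0,u_{-d},\dots,u_{-1}$. Stabilizing gain. A constant matrix $K$ is called stabilizing if, with the predictor feedback $u_{k-d}=-Kx_k|_{k-d-1}$ for $k\ge d$, for all initial data $x_0,u_{-d},\dots,u_{-1}$ the closed-loop system $x_{k+1}=A_kx_k-B_kKx_k|_{k-d-1}$ is asymptotically mean-square stable: $\lim_{k\to\infty}\mathsf E[x_k'x_k]=0$. Exact observability. $(A,\bar A\,|\,Q^{1/2})$ is exactly observable if for every initial time $j\ge0$ and every square-integrable $\mathcal F_{j-1}$-measurable $x_j$, the solution of $x_{k+1}=A_kx_k$, $k\ge j$, with output $y_k=Q^{1/2}x_k$ satisfies: if $y_k=0$ a.s. on $j\le k\le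 N$ for every $N\ge j$, then $x_j=0$ a.s. *)

theory Defs
  imports "HOL-Probability.Probability"
begin

definition possemidef :: "real^'n^'n \<Rightarrow> bool" where
  "possemidef M \<longleftrightarrow> transpose M = M \<and> (\<forall>x. 0 \<le> x \<bullet> (M *v x))"

definition posdef :: "real^'n^'n \<Rightarrow> bool" where
  "posdef M \<longleftrightarrow> transpose M = M \<and> (\<forall>x. x \<noteq> 0 \<longrightarrow> 0 < x \<bullet> (M *v x))"

definition loewner_le :: "real^'n^'n \<Rightarrow> real^'n^'n \<Rightarrow> bool" where
  "loewner_le M N \<longleftrightarrow> possemidef (N - M)"

text \<open>\<open>S\<close> is the (unique) positive semidefinite square root of \<open>Q\<close>.\<close>

definition is_psd_sqrt :: "real^'n^'n \<Rightarrow> real^'n^'n \<Rightarrow> bool" where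
  "is_psd_sqrt S Q \<longleftrightarrow> possemidef S \<and> S ** S = Q"

definition white_noise :: "'a measure \<Rightarrow> (nat \<Rightarrow> 'a \<Rightarrow> real) \<Rightarrow> bool" where
  "white_noise M w \<longleftrightarrow>
     prob_space M \<and>
     prob_space.indep_vars M (\<lambda>_. borel) w UNIV \<and>
     (\<forall>k. integrable M (\<lambda>\<omega>. (w k \<omega>)\<^sup>2)) \<and>
     (\<forall>k. prob_space.expectation M (w k) = 0) \<and>
     (\<forall>k s. prob_space.expectation M (\<lambda>\<omega>. w k \<omega> * w s \<omega>) = (if k = s then 1 else 0))"

text \<open>The sigma-algebra generated by \<open>w 0, \<dots>, w m\<close>. The time index is an integer: for
  \<open>m < 0\<close> there is no generator, so the sigma-algebra is trivial.\<close>

definition noise_filtration :: "'a measure \<Rightarrow> (nat \<Rightarrow> 'a \<Rightarrow> real) \<Rightarrow> int \<Rightarrow> 'a measure" where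
  "noise_filtration M w m =
     sigma (space M) {w i -` S \<inter> space M | i S. int i \<le> m \<and> S \<in> sets borel}"

text \<open>Conditional expectation of a random vector, componentwise.\<close>

definition vec_cond_exp :: "'a measure \<Rightarrow> 'a measure \<Rightarrow> ('a \<Rightarrow> real^'n) \<Rightarrow> 'a \<Rightarrow> real^'n" where
  "vec_cond_exp M F f \<omega> = (\<chi> i. real_cond_exp M F (\<lambda>\<omega>'. f \<omega>' $ i) \<omega>)"

text \<open>\<open>x\<close> and \<open>u\<close> satisfy \<open>x\<^sub>k\<^sub>+\<^sub>1 = A\<^sub>k x\<^sub>k + B\<^sub>k u\<^sub>k\<^sub>-\<^sub>d\<close> with deterministic initial data
  \<open>x0\<close> and \<open>u0 (-d), \<dots>, u0 (-1)\<close>; only these values of \<open>u0\<close> matter.\<close>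

definition delay_trajectory ::
  "'a measure \<Rightarrow> (nat \<Rightarrow> 'a \<Rightarrow> real) \<Rightarrow> nat \<Rightarrow> real^'n^'n \<Rightarrow> real^'n^'n \<Rightarrow> real^'m^'n \<Rightarrow> real^'m^'n \<Rightarrow>
   real^'n \<Rightarrow> (int \<Rightarrow> real^'m) \<Rightarrow> (nat \<Rightarrow> 'a \<Rightarrow> real^'n) \<Rightarrow> (int \<Rightarrow> 'a \<Rightarrow> real^'m) \<Rightarrow> bool" where
  "delay_trajectory M w d A Abar B Bbar x0 u0 x u \<longleftrightarrow>
     (\<forall>\<omega>\<in>space M. x 0 \<omega> = x0) \<and>
     (\<forall>i\<in>{- int d..<0}. \<forall>\<omega>\<in>space M. u i \<omega> = u0 i) \<and>
     (\<forall>k. \<forall>\<omega>\<in>space M.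
        x (Suc k) \<omega> = (A + w k \<omega> *\<^sub>R Abar) *v x k \<omega> + (B + w k \<omega> *\<^sub>R Bbar) *v u (int k - int d) \<omega>)"

definition predictor_feedback ::
  "'a measure \<Rightarrow> (nat \<Rightarrow> 'a \<Rightarrow> real) \<Rightarrow> nat \<Rightarrow> real^'n^'m \<Rightarrow>
   (nat \<Rightarrow> 'a \<Rightarrow> real^'n) \<Rightarrow> (int \<Rightarrow> 'a \<Rightarrow> real^'m) \<Rightarrow> bool" where
  "predictor_feedback M w d K x u \<longleftrightarrow>
     (\<forall>k\<ge>d. \<forall>\<omega>\<in>space M.
        u (int k - int d) \<omega> =
          - (K *v vec_cond_exp M (noise_filtration M w (int k - int d - 1)) (x k) \<omega>))"

definition stabilizing ::
  "'a measure \<Rightarrow> (nat \<Rightarrow> 'a \<Rightarrow> real) \<Rightarrow> nat \<Rightarrow> real^'n^'n \<Rightarrow> real^'n^'n \<Rightarrow> real^'m^'n \<Rightarrow> real^'m^'n \<Rightarrow>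
   real^'n^'m \<Rightarrow> bool" where
  "stabilizing M w d A Abar B Bbar K \<longleftrightarrow>
     (\<forall>x0 u0 x u.
        delay_trajectory M w d A Abar B Bbar x0 u0 x u \<longrightarrow>
        predictor_feedback M w d K x u \<longrightarrow>
        (\<lambda>k. prob_space.expectation M (\<lambda>\<omega>. x k \<omega> \<bullet> x k \<omega>)) \<longlonglongrightarrow> 0)"

text \<open>Exact observability of \<open>(A, Abar | C)\<close>. Only the values \<open>x k\<close> with \<open>k \<ge> j\<close> matter.\<close>

definition exactly_observable ::
  "'a measure \<Rightarrow> (nat \<Rightarrow> 'a \<Rightarrow> real) \<Rightarrow> real^'n^'n \<Rightarrow> real^'n^'n \<Rightarrow> real^'n^'p \<Rightarrow> bool" where
  "exactly_observable M w A Abar C \<longleftrightarrow>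
     (\<forall>j x.
        x j \<in> borel_measurable (noise_filtration M w (int j - 1)) \<longrightarrow>
        integrable M (\<lambda>\<omega>. (norm (x j \<omega>))\<^sup>2) \<longrightarrow>
        (\<forall>k\<ge>j. \<forall>\<omega>\<in>space M. x (Suc k) \<omega> = (A + w k \<omega> *\<^sub>R Abar) *v x k \<omega>) \<longrightarrow>
        (\<forall>N\<ge>j. \<forall>k\<in>{j..N}. AE \<omega> in M. C *v x k \<omega> = 0) \<longrightarrow>
        (AE \<omega> in M. x j \<omega> = 0))"

text \<open>The Lyapunov-type equations for the gain \<open>K\<close> in the unknowns \<open>P 0, \<dots>, P d\<close>; the values
  \<open>P i\<close> with \<open>i > d\<close> are irrelevant.\<close>

definition lyapunov_eqs ::
  "nat \<Rightarrow> real^'n^'n \<Rightarrow> real^'n^'n \<Rightarrow> real^'m^'n \<Rightarrow> real^'m^'n \<Rightarrow> real^'n^'n \<Rightarrow> real^'m^'m \<Rightarrow>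
   real^'n^'m \<Rightarrow> (nat \<Rightarrow> real^'n^'n) \<Rightarrow> bool" where
  "lyapunov_eqs d A Abar B Bbar Q R K P \<longleftrightarrow>
     (\<forall>i\<in>{1..d}. P (i - 1) = transpose A ** P i ** A + transpose Abar ** P 0 ** Abar + Q) \<and>
     P d = transpose (A - B ** K) ** P d ** (A - B ** K)
           + transpose (Abar - Bbar ** K) ** P 0 ** (Abar - Bbar ** K)
           + transpose K ** R ** K + Q"

definition posdef_lyapunov_solution ::
  "nat \<Rightarrow> real^'n^'n \<Rightarrow> real^'n^'n \<Rightarrow> real^'m^'n \<Rightarrow> real^'m^'n \<Rightarrow> real^'n^'n \<Rightarrow> real^'m^'m \<Rightarrow>
   real^'n^'m \<Rightarrow> (nat \<Rightarrow> real^'n^'n) \<Rightarrow> bool" where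
  "posdef_lyapunov_solution d A Abar B Bbar Q R K P \<longleftrightarrow>
     (\<forall>i\<le>d. posdef (P i)) \<and> lyapunov_eqs d A Abar B Bbar Q R K P"

definition gain_of ::
  "nat \<Rightarrow> real^'n^'n \<Rightarrow> real^'n^'n \<Rightarrow> real^'m^'n \<Rightarrow> real^'m^'n \<Rightarrow> real^'m^'m \<Rightarrow>
   (nat \<Rightarrow> real^'n^'n) \<Rightarrow> real^'n^'m" where
  "gain_of d A Abar B Bbar R P =
     matrix_inv (R + transpose B ** P d ** B + transpose Bbar ** P 0 ** Bbar) **
       (transpose B ** P d ** A + transpose Bbar ** P 0 ** Abar)"

text \<open>\<open>P j i\<close> is the matrix with iteration index \<open>j\<close> (subscript) and equation index \<open>i\<close>
  (superscript).\<close>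

definition policy_iteration ::
  "nat \<Rightarrow> real^'n^'n \<Rightarrow> real^'n^'n \<Rightarrow> real^'m^'n \<Rightarrow> real^'m^'n \<Rightarrow> real^'n^'n \<Rightarrow> real^'m^'m \<Rightarrow>
   real^'n^'m \<Rightarrow> (nat \<Rightarrow> nat \<Rightarrow> real^'n^'n) \<Rightarrow> (nat \<Rightarrow> real^'n^'m) \<Rightarrow> bool" where
  "policy_iteration d A Abar B Bbar Q R K0 P K \<longleftrightarrow>
     K 0 = K0 \<and>
     (\<forall>j. posdef_lyapunov_solution d A Abar B Bbar Q R (K j) (P j)) \<and>
     (\<forall>j. K (Suc j) = gain_of d A Abar B Bbar R (P j))"

end

(*
  The predictor splits the state into orthogonal parts
    x_k = E[x_k | F_(k-d-1)] + (sum over i < d of (E[x_k | F_(k-1-i)] - E[x_k | F_(k-2-i)])).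
  Under the feedback with gain K, the vector of their second moments evolves by a positive linear
  map on (d + 1)-tuples of symmetric matrices, and the adjoint of that map is the homogeneous part
  P |-> lyap K P of the Lyapunov-type equations.  Every elementary initial second moment is realised
  by suitable deterministic initial data, so K is stabilizing iff the powers of lyap K tend to 0 on
  the tuple of identity matrices.

  For stable K the series of lyap K applied to the cost converges and gives the unique solution.
  Observability forces every positive semidefinite solution P to be positive definite, because the
  union of the kernels of the P i is mapped into itself by A and Abar.  Conversely, if P is such a
  solution for K, then lyap K ^ k P decreases to a fixed point L; P - L is again a solution, hence
  positive definite and dominating a multiple of P, while lyap K ^ k (P - L) tends to 0: so K is
  stable.  Completing the square shows that P_j is a supersolution of the equations for K_(j+1),
  which yields a solution below P_j; monotone convergence gives the limits.
*)

theory Submission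
  imports Defs
begin

section \<open>Quadratic forms of symmetric matrices\<close>

text \<open>Symmetric matrices are handled through their quadratic forms: by polarization
  \<open>qf\<close> determines the matrix, the Loewner order becomes inequalities between reals, and
  limits of matrices reduce to limits of real sequences. Tuples are functions on the naturals of
  which only the indices up to \<open>d\<close> matter.

  Two obstacles shape the proof. The cost is only semidefinite, so a solution gives a tuple that
  decreases under \<open>lyap K\<close> without any rate; this is why the limit is subtracted and
  observability is used again on the difference. Also, initial data are deterministic, so at time 0
  only the predicted part, index \<open>d\<close>, can be nonzero. Index 0 is reached by letting the
  system run \<open>d\<close> steps with zero input, and the remaining indices are recovered from
  the shape of \<open>lyap\<close> itself.

  Conditional expectations are known only up to null sets. The parts of the state are therefore
  defined by a pathwise recursion, and \<open>predicted\<close> is identified with the predictor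
  almost everywhere afterwards. Observability enters through deterministic initial vectors and
  second moments, which makes it an algebraic condition on \<open>A\<close>, \<open>Abar\<close> and
  \<open>Q\<close>.\<close>

definition qf :: "real^'n^'n \<Rightarrow> real^'n \<Rightarrow> real" where
  "qf P x = x \<bullet> (P *v x)"

lemma inner_matrix_vector_left: "(P *v x) \<bullet> y = x \<bullet> (transpose P *v y)"
  for P :: "real^'n^'m"
  by (metis dot_lmul_matrix inner_commute transpose_matrix_vector)

lemma transpose_add: "transpose (M + N) = transpose M + transpose N"
  for M N :: "real^'n^'m"
  by (simp add: transpose_def vec_eq_iff)

lemma transpose_diff: "transpose (M - N) = transpose M - transpose N"
  for M N :: "real^'n^'m"
  by (simp add: transpose_def vec_eq_iff)

lemma transpose_zero: "transpose (0 :: real^'n^'m) = 0"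
  by (simp add: transpose_def vec_eq_iff)

lemma transpose_scaleR: "transpose (c *\<^sub>R M) = c *\<^sub>R transpose M"
  for M :: "real^'n^'m"
  by (simp add: transpose_def vec_eq_iff)

lemma matrix_diff_ldistrib: "(A - B) ** C = A ** C - B ** C"
  for A B :: "real^'n^'m" and C :: "real^'p^'n"
  by (simp add: matrix_matrix_mult_def vec_eq_iff left_diff_distrib sum_subtractf)

lemma matrix_diff_rdistrib: "C ** (A - B) = C ** A - C ** B"
  for A B :: "real^'p^'n" and C :: "real^'n^'m"
  by (simp add: matrix_matrix_mult_def vec_eq_iff right_diff_distrib sum_subtractf)

lemma matrix_vector_mult_minus_left: "(- P) *v y = - (P *v y)"
  for P :: "real^'n^'m"
  using matrix_vector_mult_diff_rdistrib[of 0 P y] by simp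

lemma symmetric_congruence:
  "transpose P = P \<Longrightarrow> transpose (transpose C ** P ** C) = transpose C ** P ** C"
  for P :: "real^'m^'m" and C :: "real^'n^'m"
  by (simp add: matrix_transpose_mul matrix_mul_assoc)

lemma qf_congruence: "qf (transpose C ** P ** C) x = qf P (C *v x)"
  for P :: "real^'m^'m" and C :: "real^'n^'m"
  unfolding qf_def
  by (metis inner_matrix_vector_left matrix_vector_mul_assoc)

lemma qf_add: "qf (P + P') x = qf P x + qf P' x"
  by (simp add: qf_def matrix_vector_mult_add_rdistrib inner_add_right)

lemma qf_diff: "qf (P - P') x = qf P x - qf P' x"
  by (simp add: qf_def matrix_vector_mult_diff_rdistrib inner_diff_right)

lemma qf_minus: "qf (- P) x = - qf P x"
  using qf_diff[of 0 P x] by (simp add: qf_def)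

lemma qf_scaleR: "qf (c *\<^sub>R P) x = c * qf P x"
  by (simp add: qf_def scaleR_matrix_vector_assoc[symmetric])

lemma qf_scaleR_vec: "qf P (c *\<^sub>R x) = c\<^sup>2 * qf P x"
  by (simp add: qf_def matrix_vector_mult_scaleR power2_eq_square)

lemma qf_zero [simp]: "qf 0 x = 0"
  by (simp add: qf_def)

lemma qf_zero_vec [simp]: "qf P 0 = 0"
  by (simp add: qf_def)

lemma qf_mat1: "qf (mat 1) x = (norm x)\<^sup>2"
  by (simp add: qf_def power2_norm_eq_inner)

lemma qf_sum: "qf (\<Sum>i\<in>I. P i) x = (\<Sum>i\<in>I. qf (P i) x)"
  by (induction I rule: infinite_finite_induct) (auto simp: qf_add)

lemma possemidef_qf: "possemidef P \<longleftrightarrow> transpose P = P \<and> (\<forall>x. 0 \<le> qf P x)"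
  by (simp add: possemidef_def qf_def)

lemma posdef_qf: "posdef P \<longleftrightarrow> transpose P = P \<and> (\<forall>x. x \<noteq> 0 \<longrightarrow> 0 < qf P x)"
  by (simp add: posdef_def qf_def)

lemma qf_polarization:
  assumes "transpose P = P"
  shows "2 * (x \<bullet> (P *v y)) = qf P (x + y) - qf P x - qf P y"
proof -
  have "y \<bullet> (P *v x) = x \<bullet> (P *v y)"
    by (metis assms inner_commute inner_matrix_vector_left)
  then show ?thesis
    by (simp add: qf_def inner_add_left inner_add_right matrix_vector_right_distrib)
qed

lemma matrix_nth_inner: "P $ i $ j = axis i 1 \<bullet> (P *v axis j 1)" for P :: "real^'n^'m"
  by (simp add: inner_axis' matrix_vector_mult_basis column_def)

lemma matrix_nth_qf:
  assumes "transpose P = P"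
  shows "P $ i $ j = (qf P (axis i 1 + axis j 1) - qf P (axis i 1) - qf P (axis j 1)) / 2"
  using qf_polarization[OF assms, of "axis i 1" "axis j 1"] by (simp add: matrix_nth_inner)

lemma symmetric_eqI:
  assumes "transpose P = P" "transpose P' = P'" "\<And>x. qf P x = qf P' x"
  shows "P = P'"
proof -
  have "P $ i $ j = P' $ i $ j" for i j
    unfolding matrix_nth_qf[OF assms(1)] matrix_nth_qf[OF assms(2)] assms(3) ..
  then show ?thesis by (simp add: vec_eq_iff)
qed

lemma tendsto_matrix_mult [tendsto_intros]:
  fixes P :: "real^'n^'m" and P' :: "real^'p^'n"
  assumes "(f \<longlongrightarrow> P) F" "(g \<longlongrightarrow> P') F"
  shows "((\<lambda>x. f x ** g x) \<longlongrightarrow> P ** P') F"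
  unfolding matrix_matrix_mult_def by (intro tendsto_intros assms)

lemma tendsto_matrix_vector_mult [tendsto_intros]:
  fixes P :: "real^'n^'m" and y :: "real^'n"
  assumes "(f \<longlongrightarrow> P) F" "(g \<longlongrightarrow> y) F"
  shows "((\<lambda>x. f x *v g x) \<longlongrightarrow> P *v y) F"
  unfolding matrix_vector_mult_def by (intro tendsto_intros assms)

lemma tendsto_transpose [tendsto_intros]:
  fixes P :: "real^'n^'m"
  assumes "(f \<longlongrightarrow> P) F"
  shows "((\<lambda>x. transpose (f x)) \<longlongrightarrow> transpose P) F"
  unfolding transpose_def by (intro tendsto_intros assms)

lemma tendsto_qf [tendsto_intros]:
  assumes "(f \<longlongrightarrow> P) F"
  shows "((\<lambda>x. qf (f x) y) \<longlongrightarrow> qf P y) F"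
  unfolding qf_def by (intro tendsto_intros assms)

text \<open>By polarization at basis vectors each entry is a fixed linear combination of three
  values of the form. For monotone bounded forms this is monotone convergence in the Loewner
  order.\<close>

lemma symmetric_convergent:
  assumes sym: "\<And>n. transpose (S n) = S n" and conv: "\<And>x. convergent (\<lambda>n. qf (S n) x)"
  obtains L where "S \<longlonglongrightarrow> L" "transpose L = L"
proof -
  have "\<exists>l. (\<lambda>n. S n $ i $ j) \<longlonglongrightarrow> l" for i j
  proof -
    obtain a b c where "(\<lambda>n. qf (S n) (axis i 1 + axis j 1)) \<longlonglongrightarrow> a"
      "(\<lambda>n. qf (S n) (axis i 1)) \<longlonglongrightarrow> b" "(\<lambda>n. qf (S n) (axis j 1)) \<longlonglongrightarrow> c"
      using conv unfolding convergent_def by metis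
    then have "(\<lambda>n. (qf (S n) (axis i 1 + axis j 1) - qf (S n) (axis i 1) - qf (S n) (axis j 1)) / 2)
        \<longlonglongrightarrow> (a - b - c) / 2"
      by (intro tendsto_intros) auto
    then show ?thesis
      unfolding matrix_nth_qf[OF sym] by blast
  qed
  then obtain l where l: "\<And>i j. (\<lambda>n. S n $ i $ j) \<longlonglongrightarrow> l i j"
    by metis
  have lim: "S \<longlonglongrightarrow> (\<chi> i j. l i j)"
    by (intro vec_tendstoI) (simp add: l)
  have "(\<lambda>n. transpose (S n)) \<longlonglongrightarrow> transpose (\<chi> i j. l i j)"
    by (intro tendsto_intros lim)
  then have "transpose (\<chi> i j. l i j) = (\<chi> i j. l i j)"
    using lim by (simp add: sym LIMSEQ_unique)
  with lim that show thesis by blast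
qed

lemma symmetric_tendstoI:
  assumes sym: "\<And>n. transpose (S n) = S n" "transpose P = P"
    and conv: "\<And>x. (\<lambda>n. qf (S n) x) \<longlonglongrightarrow> qf P x"
  shows "S \<longlonglongrightarrow> P"
proof -
  have "convergent (\<lambda>n. qf (S n) x)" for x
    using conv by (rule convergentI)
  then obtain L where L: "S \<longlonglongrightarrow> L" "transpose L = L"
    using symmetric_convergent sym(1) by blast
  have "qf L x = qf P x" for x
    using LIMSEQ_unique[OF tendsto_qf[OF L(1)] conv] by simp
  with L sym(2) show ?thesis
    using symmetric_eqI by blast
qed

text \<open>The factor is independent of \<open>P\<close>, so matrices tending to 0 have forms
  tending to 0 uniformly on bounded sets of vectors.\<close>

lemma qf_le_norm:
  obtains c where "c \<ge> 0" "\<And>P x. \<bar>qf P x\<bar> \<le> c * norm (P::real^'n^'n) * (norm x)\<^sup>2"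
proof
  let ?c = "real CARD('n) * real CARD('n)"
  show "?c \<ge> 0" by simp
  fix P :: "real^'n^'n" and x
  have "onorm ((*v) P) \<le> ?c * norm P"
  proof (rule onorm_le_matrix_component)
    fix i j
    have "\<bar>P $ i $ j\<bar> \<le> norm (P $ i)" by (rule component_le_norm_cart)
    also have "\<dots> \<le> norm P" by (rule Finite_Cartesian_Product.norm_nth_le)
    finally show "\<bar>P $ i $ j\<bar> \<le> norm P" .
  qed
  then have "norm (P *v x) \<le> ?c * norm P * norm x"
    using onorm[OF matrix_vector_mul_bounded_linear, of P x]
    by (meson mult_right_mono norm_ge_zero order_trans)
  then have "norm x * norm (P *v x) \<le> norm x * (?c * norm P * norm x)"
    by (intro mult_left_mono) auto
  then show "\<bar>qf P x\<bar> \<le> ?c * norm P * (norm x)\<^sup>2"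
    unfolding qf_def using Cauchy_Schwarz_ineq2[of x "P *v x"]
    by (simp add: power2_eq_square mult_ac)
qed

lemma qf_bounded:
  obtains c where "c > 0" "\<And>x. qf (P::real^'n^'n) x \<le> c * (norm x)\<^sup>2"
proof -
  obtain c where c: "c \<ge> 0" "\<And>P x. \<bar>qf P x\<bar> \<le> c * norm (P::real^'n^'n) * (norm x)\<^sup>2"
    using qf_le_norm by blast
  have "qf P x \<le> (c * norm P + 1) * (norm x)\<^sup>2" for x
    using c(2)[of P x] by (simp add: distrib_right) (smt (verit) zero_le_power2)
  with c(1) that[of "c * norm P + 1"] show thesis
    by (simp add: add_nonneg_pos)
qed

lemma posdef_coercive:
  assumes "posdef P"
  obtains r :: real where "r > 0" "\<And>x. r * (norm x)\<^sup>2 \<le> qf P x"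
proof -
  have "continuous_on (sphere 0 1) (qf P)"
    unfolding qf_def by (intro continuous_intros matrix_vector_mult_linear_continuous_on)
  \<comment> \<open>Nonemptiness of the unit sphere, so that the minimum is attained.\<close>
  moreover have "axis undefined 1 \<in> sphere (0::real^'a) 1"
    by simp
  ultimately obtain m where m: "m \<in> sphere 0 1" "\<And>y. y \<in> sphere 0 1 \<Longrightarrow> qf P m \<le> qf P y"
    using continuous_attains_inf[of "sphere 0 1" "qf P"] compact_sphere by fastforce
  have pos: "qf P m > 0"
  proof -
    have "m \<noteq> 0" using m(1) by auto
    then show ?thesis using assms unfolding posdef_qf by blast
  qed
  have "qf P m * (norm x)\<^sup>2 \<le> qf P x" for x
  proof (cases "x = 0")
    case False
    have "qf P x = (norm x)\<^sup>2 * qf P (x /\<^sub>R norm x)"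
      using False by (simp add: qf_scaleR_vec power_inverse)
    moreover have "qf P m \<le> qf P (x /\<^sub>R norm x)"
      using False by (intro m(2)) simp
    ultimately show ?thesis
      by (metis mult.commute mult_left_mono zero_le_power2)
  qed simp
  with pos that show thesis by blast
qed

section \<open>The Lyapunov-type equations\<close>

lemma posdef_imp_invertible:
  assumes "posdef P"
  shows "invertible P"
proof -
  have "x = 0" if "P *v x = 0" for x
    using assms that unfolding posdef_def by (metis inner_zero_right less_irrefl)
  then show ?thesis
    by (metis invertible_left_inverse matrix_left_invertible_ker)
qed

lemma matrix_inv_right_mult: "invertible P \<Longrightarrow> P ** matrix_inv P = mat 1"
  for P :: "real^'n^'n"
  unfolding invertible_def matrix_inv_def by (metis (mono_tags, lifting) someI_ex)

lemma scaleR_matrix_mult_left: "(c *\<^sub>R M) ** N = c *\<^sub>R (M ** N)"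
  for M :: "real^'n^'m" and N :: "real^'p^'n"
  by (simp add: matrix_matrix_mult_def vec_eq_iff sum_distrib_left mult.assoc)

lemma scaleR_matrix_mult_right: "M ** (c *\<^sub>R N) = c *\<^sub>R (M ** N)"
  for M :: "real^'n^'m" and N :: "real^'p^'n"
  by (simp add: matrix_matrix_mult_def vec_eq_iff sum_distrib_left mult_ac)

locale delay_lqr =
  fixes d :: nat and A Abar :: "real^'n^'n" and B Bbar :: "real^'m^'n"
    and Q :: "real^'n^'n" and R :: "real^'m^'m"
  assumes Q: "possemidef Q" and R: "posdef R"
begin

text \<open>The feedback sees only the predicted part of the state, which has index
  \<open>d\<close>; the innovations, with indices below \<open>d\<close>, move as in the
  uncontrolled system.\<close>

definition drift :: "real^'n^'m \<Rightarrow> nat \<Rightarrow> real^'n^'n" where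
  "drift K i = (if i < d then A else A - B ** K)"

definition diffusion :: "real^'n^'m \<Rightarrow> nat \<Rightarrow> real^'n^'n" where
  "diffusion K i = (if i < d then Abar else Abar - Bbar ** K)"

text \<open>\<open>min (Suc i) d\<close> covers both kinds of equations: \<open>i < d\<close> uses \<open>P (Suc i)\<close>, and \<open>i = d\<close> uses \<open>P d\<close>.\<close>

definition lyap :: "real^'n^'m \<Rightarrow> (nat \<Rightarrow> real^'n^'n) \<Rightarrow> nat \<Rightarrow> real^'n^'n" where
  "lyap K P i = transpose (drift K i) ** P (min (Suc i) d) ** drift K i
     + transpose (diffusion K i) ** P 0 ** diffusion K i"

definition cost :: "real^'n^'m \<Rightarrow> nat \<Rightarrow> real^'n^'n" where
  "cost K i = (if i < d then Q else transpose K ** R ** K + Q)"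

definition lyap_step :: "real^'n^'m \<Rightarrow> (nat \<Rightarrow> real^'n^'n) \<Rightarrow> nat \<Rightarrow> real^'n^'n" where
  "lyap_step K P i = lyap K P i + cost K i"

definition solves :: "real^'n^'m \<Rightarrow> (nat \<Rightarrow> real^'n^'n) \<Rightarrow> bool" where
  "solves K P \<longleftrightarrow> (\<forall>i\<le>d. P i = lyap_step K P i)"

definition symm :: "(nat \<Rightarrow> real^'n^'n) \<Rightarrow> bool" where
  "symm P \<longleftrightarrow> (\<forall>i\<le>d. transpose (P i) = P i)"

text \<open>The componentwise Loewner order, stated through forms so that monotonicity of
  \<open>lyap\<close> involves no symmetry conditions.\<close>

definition qle :: "(nat \<Rightarrow> real^'n^'n) \<Rightarrow> (nat \<Rightarrow> real^'n^'n) \<Rightarrow> bool" where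
  "qle P P' \<longleftrightarrow> (\<forall>i\<le>d. \<forall>x. qf (P i) x \<le> qf (P' i) x)"

text \<open>The identity tuple is an order unit: every tuple lies below a multiple of it. As
  \<open>lyap K\<close> is monotone, decay on this one tuple forces decay on all tuples of symmetric
  matrices.\<close>

definition stable :: "real^'n^'m \<Rightarrow> bool" where
  "stable K \<longleftrightarrow> (\<forall>i\<le>d. \<forall>x. (\<lambda>k. qf ((lyap K ^^ k) (\<lambda>_. mat 1) i) x) \<longlonglongrightarrow> 0)"

lemma lyapunov_eqs_iff_solves: "lyapunov_eqs d A Abar B Bbar Q R K P \<longleftrightarrow> solves K P"
proof
  assume L: "lyapunov_eqs d A Abar B Bbar Q R K P"
  show "solves K P"
    unfolding solves_def
  proof (intro allI impI)
    fix i assume "i \<le> d"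
    show "P i = lyap_step K P i"
    proof (cases "i < d")
      case True
      then have "Suc i \<in> {1..d}" by auto
      with L have "P (Suc i - 1) = transpose A ** P (Suc i) ** A + transpose Abar ** P 0 ** Abar + Q"
        unfolding lyapunov_eqs_def by blast
      with True show ?thesis
        by (simp add: lyap_step_def lyap_def cost_def drift_def diffusion_def min_def)
    next
      case False
      with \<open>i \<le> d\<close> L show ?thesis
        by (simp add: lyapunov_eqs_def lyap_step_def lyap_def cost_def drift_def diffusion_def min_def add.assoc)
    qed
  qed
next
  assume S: "solves K P"
  have "P (i - 1) = transpose A ** P i ** A + transpose Abar ** P 0 ** Abar + Q" if "i \<in> {1..d}" for i
  proof -
    have "i - 1 < d" "Suc (i - 1) = i" using that by auto
    with S[unfolded solves_def, rule_format, of "i - 1"] show ?thesis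
      by (simp add: lyap_step_def lyap_def cost_def drift_def diffusion_def min_def)
  qed
  moreover have "P d = transpose (A - B ** K) ** P d ** (A - B ** K)
           + transpose (Abar - Bbar ** K) ** P 0 ** (Abar - Bbar ** K)
           + transpose K ** R ** K + Q"
    using S[unfolded solves_def, rule_format, of d]
    by (simp add: lyap_step_def lyap_def cost_def drift_def diffusion_def min_def add.assoc)
  ultimately show "lyapunov_eqs d A Abar B Bbar Q R K P"
    by (simp add: lyapunov_eqs_def)
qed

lemma qf_lyap:
  "qf (lyap K P i) x = qf (P (min (Suc i) d)) (drift K i *v x) + qf (P 0) (diffusion K i *v x)"
  by (simp add: lyap_def qf_add qf_congruence)

lemma qf_lyap_step: "qf (lyap_step K P i) x = qf (lyap K P i) x + qf (cost K i) x"
  by (simp add: lyap_step_def qf_add)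

lemma symm_lyap: "symm P \<Longrightarrow> symm (lyap K P)"
  by (simp add: symm_def lyap_def transpose_add symmetric_congruence)

lemma symm_cost: "symm (cost K)"
  using Q R by (simp add: symm_def cost_def transpose_add symmetric_congruence posdef_def possemidef_def)

lemma symm_lyap_step: "symm P \<Longrightarrow> symm (lyap_step K P)"
  using symm_lyap[of P K] symm_cost[of K] by (simp add: symm_def lyap_step_def transpose_add)

lemma symm_lyap_power: "symm P \<Longrightarrow> symm ((lyap K ^^ k) P)"
  by (induction k) (auto simp: symm_lyap)

lemma symm_one: "symm (\<lambda>_. mat 1)"
  by (simp add: symm_def)

lemma qf_cost_nonneg: "0 \<le> qf (cost K i) x"
proof -
  have "0 \<le> qf Q x" "0 \<le> qf R y" for y
    using Q R unfolding possemidef_qf posdef_qf by (auto, metis order.refl less_imp_le qf_zero_vec)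
  then show ?thesis by (simp add: cost_def qf_add qf_congruence)
qed

lemma qle_trans: "qle P P' \<Longrightarrow> qle P' P'' \<Longrightarrow> qle P P''"
  unfolding qle_def by (meson order_trans)

lemma qle_lyap: "qle P P' \<Longrightarrow> qle (lyap K P) (lyap K P')"
  by (simp add: qle_def qf_lyap add_mono)

lemma qle_lyap_power: "qle P P' \<Longrightarrow> qle ((lyap K ^^ k) P) ((lyap K ^^ k) P')"
  by (induction k) (auto simp: qle_lyap)

lemma qle_lyap_step: "qle P P' \<Longrightarrow> qle (lyap_step K P) (lyap_step K P')"
  using qle_lyap[of P P' K] by (simp add: qle_def qf_lyap_step)

text \<open>The equality holds at every index, even above \<open>d\<close>, because
  \<open>min (Suc i) d\<close> never exceeds \<open>d\<close>.\<close>

lemma lyap_cong: "(\<And>i. i \<le> d \<Longrightarrow> P i = P' i) \<Longrightarrow> lyap K P = lyap K P'"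
  by (simp add: fun_eq_iff lyap_def)

lemma lyap_power_scaleR: "(lyap K ^^ k) (\<lambda>i. c *\<^sub>R P i) = (\<lambda>i. c *\<^sub>R (lyap K ^^ k) P i)"
  by (induction k)
    (simp_all add: lyap_def[abs_def] scaleR_add_right scaleR_matrix_mult_left scaleR_matrix_mult_right)

lemma lyap_diff: "lyap K (\<lambda>i. P i - P' i) i = lyap K P i - lyap K P' i"
  by (simp add: lyap_def matrix_diff_ldistrib matrix_diff_rdistrib)

lemma lyap_power_diff:
  "(lyap K ^^ k) (\<lambda>i. P i - P' i) = (\<lambda>i. (lyap K ^^ k) P i - (lyap K ^^ k) P' i)"
  by (induction k) (simp_all add: lyap_diff[abs_def])

lemma tendsto_lyap:
  assumes "\<And>i. i \<le> d \<Longrightarrow> (\<lambda>n. S n i) \<longlonglongrightarrow> L i"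
  shows "(\<lambda>n. lyap K (S n) i) \<longlonglongrightarrow> lyap K L i"
  unfolding lyap_def by (intro tendsto_intros assms) auto

text \<open>Iterating \<open>lyap_step K\<close> from 0 gives an increasing sequence trapped below
  the supersolution \<open>W\<close>; by continuity its limit is a fixed point. The iterates are the
  partial sums of the series of \<open>lyap K\<close> applied to the cost.\<close>

lemma minimal_solution:
  assumes W: "symm W" "qle (\<lambda>_. 0) W" "qle (lyap_step K W) W"
  obtains P where "symm P" "qle (\<lambda>_. 0) P" "qle P W" "solves K P"
proof -
  define S where "S n = (lyap_step K ^^ n) (\<lambda>_. 0)" for n
  have S0: "S 0 = (\<lambda>_. 0)" and SS: "S (Suc n) = lyap_step K (S n)" for n
    by (auto simp: S_def)
  have sym: "symm (S n)" for n
    by (induction n) (auto simp: S0 SS symm_lyap_step, simp add: symm_def transpose_zero)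
  have bound: "qle (S n) W" for n
  proof (induction n)
    case (Suc n)
    then show ?case
      unfolding SS using qle_lyap_step qle_trans W(3) by blast
  qed (simp add: S0 W)
  have inc: "qle (S n) (S (Suc n))" for n
  proof (induction n)
    case 0
    then show ?case by (auto simp: S0 SS qle_def qf_lyap_step qf_lyap qf_cost_nonneg)
  next
    case (Suc n)
    then show ?case unfolding SS by (rule qle_lyap_step[of _ "lyap_step K (S n)", unfolded])
  qed
  have incs: "incseq (\<lambda>n. qf (S n i) x)" if "i \<le> d" for i x
    using inc that by (intro incseq_SucI) (simp add: qle_def)
  have "\<exists>L. (\<lambda>n. S n i) \<longlonglongrightarrow> L \<and> transpose L = L" if "i \<le> d" for i
  proof -
    have "convergent (\<lambda>n. qf (S n i) x)" for x
      using incs[OF that] bound that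
      by (intro Bseq_mono_convergent BseqI'[of _ "\<bar>qf (W i) x\<bar>"])
        (auto simp: qle_def incseq_def, smt (verit) S0 qf_zero incs incseqD le0 that)
    moreover have "transpose (S n i) = S n i" for n
      using sym that by (auto simp: symm_def)
    ultimately show ?thesis using symmetric_convergent by metis
  qed
  then obtain L where L: "\<And>i. i \<le> d \<Longrightarrow> (\<lambda>n. S n i) \<longlonglongrightarrow> L i" "\<And>i. i \<le> d \<Longrightarrow> transpose (L i) = L i"
    by metis
  have "solves K L"
    unfolding solves_def
  proof (intro allI impI)
    fix i assume i: "i \<le> d"
    have "(\<lambda>n. S (Suc n) i) \<longlonglongrightarrow> lyap_step K L i"
      unfolding SS lyap_step_def by (intro tendsto_intros tendsto_lyap L)
    moreover have "(\<lambda>n. S (Suc n) i) \<longlonglongrightarrow> L i"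
      using L(1)[OF i] by (rule LIMSEQ_Suc)
    ultimately show "L i = lyap_step K L i"
      using LIMSEQ_unique by blast
  qed
  moreover have "symm L" using L by (simp add: symm_def)
  moreover have "qle (\<lambda>_. 0) L"
    unfolding qle_def
  proof (intro allI impI)
    fix i x assume i: "i \<le> d"
    have "qf (S 0 i) x \<le> qf (L i) x"
      by (rule incseq_le[OF incs[OF i] tendsto_qf[OF L(1)[OF i]]])
    then show "qf 0 x \<le> qf (L i) x" by (simp add: S0)
  qed
  moreover have "qle L W"
    unfolding qle_def
  proof (intro allI impI)
    fix i x assume i: "i \<le> d"
    show "qf (L i) x \<le> qf (W i) x"
      by (rule LIMSEQ_le_const2[OF tendsto_qf[OF L(1)[OF i]]]) (use bound i in \<open>auto simp: qle_def\<close>)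
  qed
  ultimately show thesis using that by blast
qed

section \<open>Stable gains: uniform decay, existence and uniqueness of solutions\<close>

lemma stable_tendsto_zero:
  assumes "stable K" "i \<le> d"
  shows "(\<lambda>k. (lyap K ^^ k) (\<lambda>_. mat 1) i) \<longlonglongrightarrow> 0"
proof (rule symmetric_tendstoI)
  show "transpose ((lyap K ^^ n) (\<lambda>_. mat 1) i) = (lyap K ^^ n) (\<lambda>_. mat 1) i" for n
    using symm_lyap_power[OF symm_one] assms(2) by (auto simp: symm_def)
  show "(\<lambda>n. qf ((lyap K ^^ n) (\<lambda>_. mat 1) i) x) \<longlonglongrightarrow> qf 0 x" for x
    using assms by (simp add: stable_def)
qed (simp add: transpose_zero)

text \<open>Convergence of finitely many matrices in norm turns pointwise decay into one exponent
  that serves all \<open>i\<close> and \<open>x\<close>.\<close>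

lemma stable_power_small:
  assumes "stable K" "e > 0"
  obtains N where "\<And>i x. i \<le> d \<Longrightarrow> qf ((lyap K ^^ N) (\<lambda>_. mat 1) i) x \<le> e * (norm x)\<^sup>2"
proof -
  let ?S = "\<lambda>k. (lyap K ^^ k) (\<lambda>_. mat 1)"
  obtain c where c: "c \<ge> 0" "\<And>P x. \<bar>qf P x\<bar> \<le> c * norm (P::real^'n^'n) * (norm x)\<^sup>2"
    using qf_le_norm by blast
  have ev: "\<forall>\<^sub>F k in sequentially. c * norm (?S k i) < e" if i: "i \<le> d" for i
  proof -
    have "(\<lambda>k. ?S k i) \<longlonglongrightarrow> 0"
      by (rule stable_tendsto_zero[OF assms(1) i])
    then have "(\<lambda>k. c * norm (?S k i)) \<longlonglongrightarrow> c * norm (0::real^'n^'n)"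
      by (intro tendsto_intros)
    with assms(2) show ?thesis by (simp add: order_tendstoD(2))
  qed
  have "\<forall>\<^sub>F k in sequentially. \<forall>i\<in>{..d}. c * norm (?S k i) < e"
    using ev by (intro eventually_ball_finite) auto
  then obtain N where N: "\<And>i. i \<le> d \<Longrightarrow> c * norm (?S N i) < e"
    unfolding eventually_sequentially by auto
  have "qf (?S N i) x \<le> e * (norm x)\<^sup>2" if "i \<le> d" for i x
  proof -
    have "qf (?S N i) x \<le> c * norm (?S N i) * (norm x)\<^sup>2" using c(2) by (smt (verit))
    also have "\<dots> \<le> e * (norm x)\<^sup>2" using N[OF that] by (intro mult_right_mono) auto
    finally show ?thesis .
  qed
  with that show thesis by blast
qed

lemma tuple_bounded:
  obtains c where "c > 0" "\<And>i x. i \<le> d \<Longrightarrow> qf ((P::nat \<Rightarrow> real^'n^'n) i) x \<le> c * (norm x)\<^sup>2"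
proof -
  have "\<exists>c>0. \<forall>x. qf (P i) x \<le> c * (norm x)\<^sup>2" for i
    using qf_bounded[of "P i"] by metis
  then obtain c where c: "\<And>i. c i > 0" "\<And>i x. qf (P i) x \<le> c i * (norm x)\<^sup>2"
    by metis
  show thesis
  proof (rule that)
    show "sum c {..d} > 0" using c(1) by (intro sum_pos) auto
    fix i x assume "i \<le> d"
    then have "c i \<le> sum c {..d}" using c(1) by (intro member_le_sum) (auto simp: less_imp_le)
    with c(2)[of i x] show "qf (P i) x \<le> sum c {..d} * (norm x)\<^sup>2"
      by (meson mult_right_mono order_trans zero_le_power2)
  qed
qed

lemma tuple_dominated:
  assumes "\<And>i. i \<le> d \<Longrightarrow> posdef (P' i)"
  obtains c where "c > 0" "qle P (\<lambda>i. c *\<^sub>R P' i)"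
proof -
  have "\<exists>c>0. \<forall>x. qf (P i) x \<le> c * qf (P' i) x" if "i \<le> d" for i
  proof -
    obtain a where a: "a > 0" "\<And>x. qf (P i) x \<le> a * (norm x)\<^sup>2" using qf_bounded by metis
    obtain r :: real where r: "r > 0" "\<And>x. r * (norm x)\<^sup>2 \<le> qf (P' i) x"
      using posdef_coercive assms \<open>i \<le> d\<close> by metis
    have "qf (P i) x \<le> a / r * qf (P' i) x" for x
    proof -
      have "a * (norm x)\<^sup>2 = a / r * (r * (norm x)\<^sup>2)" using r(1) by simp
      also have "\<dots> \<le> a / r * qf (P' i) x" using r a by (intro mult_left_mono) auto
      finally show ?thesis using a(2)[of x] by linarith
    qed
    with a r show ?thesis by (metis divide_pos_pos)
  qed
  then obtain c where c: "\<And>i. i \<le> d \<Longrightarrow> c i > 0" "\<And>i x. i \<le> d \<Longrightarrow> qf (P i) x \<le> c i * qf (P' i) x"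
    by metis
  show thesis
  proof (rule that)
    show "sum c {..d} > 0" using c(1) by (intro sum_pos) auto
    show "qle P (\<lambda>i. sum c {..d} *\<^sub>R P' i)"
      unfolding qle_def
    proof (intro allI impI)
      fix i x assume i: "i \<le> d"
      then have "c i \<le> sum c {..d}" using c(1) by (intro member_le_sum) (auto simp: less_imp_le)
      moreover have "0 \<le> qf (P' i) x"
        using assms[OF i] unfolding posdef_qf by (metis less_imp_le order.refl qf_zero_vec)
      ultimately show "qf (P i) x \<le> qf (sum c {..d} *\<^sub>R P' i) x"
        using c(2)[OF i, of x] by (simp add: qf_scaleR) (meson mult_right_mono order_trans)
    qed
  qed
qed

text \<open>Convergence of the series needs no estimate of its tail: a finite sum of powers on the
  identity tuple is already a supersolution.\<close>

lemma stable_imp_solution: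
  assumes "stable K"
  obtains P where "symm P" "qle (\<lambda>_. 0) P" "solves K P"
proof -
  let ?S = "\<lambda>k. (lyap K ^^ k) (\<lambda>_. mat 1)"
  obtain c where c: "c > 0" "\<And>i x. i \<le> d \<Longrightarrow> qf (cost K i) x \<le> c * (norm x)\<^sup>2"
    using tuple_bounded by metis
  obtain N where N: "\<And>i x. i \<le> d \<Longrightarrow> qf (?S N i) x \<le> (1/2) * (norm x)\<^sup>2"
    using stable_power_small[OF assms, of "1/2"] by auto
  \<comment> \<open>Telescoping gives lyap K W = W + 2c (S_N - I), where S_N is the N-th power on
    the identity tuple. Since S_N is at most I/2, this is at most W - c I, hence at most W minus the
    cost; the factor 2 compensates the 1/2.\<close>
  define W where "W i = (2 * c) *\<^sub>R (\<Sum>k<N. ?S k i)" for i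
  have qfW: "qf (W i) x = 2 * c * (\<Sum>k<N. qf (?S k i) x)" for i x
    by (simp add: W_def qf_scaleR qf_sum)
  have S_nonneg: "0 \<le> qf (?S k i) x" if "i \<le> d" for k i x
    using that
  proof (induction k arbitrary: i x)
    case (Suc k)
    then show ?case by (simp add: qf_lyap)
  qed (simp add: qf_mat1)
  have "symm W"
  proof -
    have "transpose (\<Sum>k<n. ?S k i) = (\<Sum>k<n. ?S k i)" if "i \<le> d" for i n
      using symm_lyap_power[OF symm_one, where K = K] that
      by (induction n) (auto simp: symm_def transpose_add transpose_zero)
    then show ?thesis by (simp add: symm_def W_def transpose_scaleR)
  qed
  moreover have "qle (\<lambda>_. 0) W"
    unfolding qle_def
  proof (intro allI impI)
    fix i x assume "i \<le> d"
    with c show "qf 0 x \<le> qf (W i) x"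
      unfolding qfW qf_zero by (intro mult_nonneg_nonneg sum_nonneg S_nonneg) auto
  qed
  moreover have "qle (lyap_step K W) W"
    unfolding qle_def
  proof (intro allI impI)
    fix i x assume i: "i \<le> d"
    have "qf (lyap K W i) x = 2 * c * (\<Sum>k<N. qf (?S (Suc k) i) x)"
      by (simp add: qf_lyap qfW sum.distrib distrib_left)
    moreover have "(\<Sum>k<N. qf (?S (Suc k) i) x) = (\<Sum>k<N. qf (?S k i) x) + (qf (?S N i) x - (norm x)\<^sup>2)"
      using sum_lessThan_telescope[of "\<lambda>k. qf (?S k i) x" N]
      unfolding sum_subtractf by (simp add: qf_mat1)
    ultimately have "qf (lyap K W i) x = qf (W i) x + 2 * c * (qf (?S N i) x - (norm x)\<^sup>2)"
      unfolding qfW by (simp only: distrib_left)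
    moreover have "2 * c * (qf (?S N i) x - (norm x)\<^sup>2) \<le> 2 * c * (- (1/2) * (norm x)\<^sup>2)"
      using N[OF i, of x] c(1) by (intro mult_left_mono) auto
    ultimately show "qf (lyap_step K W i) x \<le> qf (W i) x"
      using c(2)[OF i, of x] by (simp add: qf_lyap_step)
  qed
  ultimately show thesis using minimal_solution that by metis
qed

text \<open>The difference of two solutions is fixed by \<open>lyap K\<close>, yet it stays between
  multiples of the powers on the identity tuple, which tend to 0.\<close>

lemma stable_unique_solution:
  assumes K: "stable K" and P: "symm P" "solves K P" and P': "symm P'" "solves K P'" and i: "i \<le> d"
  shows "P i = P' i"
proof -
  let ?S = "\<lambda>k. (lyap K ^^ k) (\<lambda>_. mat 1)"
  define D where "D i = P i - P' i" for i
  have D: "lyap K D i = D i" if "i \<le> d" for i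
    using P(2) P'(2) that unfolding D_def lyap_diff solves_def lyap_step_def
    by (metis add_diff_cancel_right)
  have Dpow: "(lyap K ^^ k) D i = D i" if "i \<le> d" for k i
    using that
  proof (induction k arbitrary: i)
    case (Suc k)
    have "lyap K ((lyap K ^^ k) D) = lyap K D" by (rule lyap_cong) (rule Suc.IH)
    with D Suc.prems show ?case by simp
  qed simp
  obtain c1 where c1: "c1 > 0" "\<And>i x. i \<le> d \<Longrightarrow> qf (D i) x \<le> c1 * (norm x)\<^sup>2"
    using tuple_bounded by metis
  obtain c2 where c2: "c2 > 0" "\<And>i x. i \<le> d \<Longrightarrow> qf (- D i) x \<le> c2 * (norm x)\<^sup>2"
    using tuple_bounded[of "\<lambda>i. - D i"] by metis
  have bound: "qf (D i) x \<le> c1 * qf (?S k i) x" "- qf (D i) x \<le> c2 * qf (?S k i) x" for k x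
  proof -
    \<comment> \<open>The negative is written as a scalar multiple so that
      \<open>lyap_power_scaleR\<close> moves it out of the powers.\<close>
    have "qle D (\<lambda>i. c1 *\<^sub>R mat 1)" "qle (\<lambda>i. (-1) *\<^sub>R D i) (\<lambda>i. c2 *\<^sub>R mat 1)"
      using c1 c2 by (auto simp: qle_def qf_scaleR qf_mat1)
    from this[THEN qle_lyap_power, where K = K and k = k]
    show "qf (D i) x \<le> c1 * qf (?S k i) x" "- qf (D i) x \<le> c2 * qf (?S k i) x"
      unfolding lyap_power_scaleR using Dpow i by (auto simp: qle_def qf_scaleR qf_minus)
  qed
  have "qf (D i) x = 0" for x
  proof -
    have lim: "(\<lambda>k. c * qf (?S k i) x) \<longlonglongrightarrow> c * 0" for c
      using K i unfolding stable_def by (intro tendsto_intros) auto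
    have "qf (D i) x \<le> 0" "- qf (D i) x \<le> 0"
      using LIMSEQ_le_const[OF lim] bound by (metis mult_zero_right)+
    then show ?thesis by simp
  qed
  then have "qf (P i) x = qf (P' i) x" for x
    by (simp add: D_def qf_diff)
  moreover have "transpose (P i) = P i" "transpose (P' i) = P' i"
    using P(1) P'(1) i by (auto simp: symm_def)
  ultimately show ?thesis
    using symmetric_eqI by blast
qed

end

section \<open>Policy improvement and observability\<close>

context delay_lqr
begin

text \<open>Completing the square: at index \<open>d\<close> the cost of a gain \<open>L\<close> is
  quadratic in \<open>L *v x\<close> with Hessian matrix twice \<open>M\<close>, and
  \<open>G\<close> is its critical point. The hypothesis on \<open>G\<close> is the normal equation,
  so no inverse occurs in the computation.\<close>

lemma lyap_improvement:
  assumes P: "transpose (P 0) = P 0" "transpose (P d) = P d"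
    and M: "M = R + transpose B ** P d ** B + transpose Bbar ** P 0 ** Bbar"
    and G: "M ** G = transpose B ** P d ** A + transpose Bbar ** P 0 ** Abar"
  shows "qf (lyap_step K P d) x = qf (lyap_step G P d) x + qf M ((K - G) *v x)"
proof -
  have sym: "(C *v y) \<bullet> (P' *v (C' *v x)) = y \<bullet> ((transpose C ** P' ** C') *v x)"
    for C :: "real^'m^'n" and C' P' :: "real^'n^'n" and y x
    by (metis inner_matrix_vector_left matrix_vector_mul_assoc)
  have diff: "qf P' (a - b) = qf P' a - 2 * (b \<bullet> (P' *v a)) + qf P' b"
    if "transpose P' = P'" for P' :: "real^'k^'k" and a b
  proof -
    have "a \<bullet> (P' *v b) = b \<bullet> (P' *v a)"
      by (metis that inner_commute inner_matrix_vector_left)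
    then show ?thesis
      by (simp add: qf_def matrix_vector_mult_diff_distrib inner_diff_left inner_diff_right)
  qed
  have Rsym: "transpose R = R" using R by (simp add: posdef_def)
  have Msym: "transpose M = M"
    unfolding M by (simp add: transpose_add symmetric_congruence P Rsym)
  have eq: "qf (lyap_step L P d) x
      = qf (P d) (A *v x) + qf (P 0) (Abar *v x) + qf Q x
        - 2 * ((L *v x) \<bullet> (M *v (G *v x))) + qf M (L *v x)" for L
  proof -
    have "(L *v x) \<bullet> (M *v (G *v x)) = (B *v (L *v x)) \<bullet> (P d *v (A *v x))
        + (Bbar *v (L *v x)) \<bullet> (P 0 *v (Abar *v x))"
      unfolding sym matrix_vector_mul_assoc[of M] G
      by (simp add: matrix_vector_mult_add_rdistrib inner_add_right)
    moreover have "qf M (L *v x) = qf R (L *v x) + qf (P d) (B *v (L *v x)) + qf (P 0) (Bbar *v (L *v x))"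
      unfolding M by (simp only: qf_add qf_congruence)
    moreover have "qf (lyap_step L P d) x = qf (P d) (A *v x - B *v (L *v x))
        + qf (P 0) (Abar *v x - Bbar *v (L *v x)) + qf R (L *v x) + qf Q x"
      by (simp add: qf_lyap_step qf_lyap cost_def drift_def diffusion_def qf_add qf_congruence
          matrix_vector_mult_diff_rdistrib matrix_vector_mul_assoc)
    ultimately show ?thesis
      unfolding diff[OF P(1)] diff[OF P(2)] by (simp add: algebra_simps)
  qed
  have "qf M ((K - G) *v x) = qf M (K *v x) - 2 * ((K *v x) \<bullet> (M *v (G *v x))) + qf M (G *v x)"
    unfolding matrix_vector_mult_diff_rdistrib diff[OF Msym]
    by (metis Msym inner_commute inner_matrix_vector_left)
  then show ?thesis
    unfolding eq by (simp add: qf_def)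
qed

text \<open>The adjoint of the second-moment map of the uncontrolled system: the expectation of
  \<open>qf X\<close> at time k+1 is that of \<open>qf (free_op X)\<close> at time k.\<close>

definition free_op :: "real^'n^'n \<Rightarrow> real^'n^'n" where
  "free_op X = transpose A ** X ** A + transpose Abar ** X ** Abar"

lemma qf_free_op: "qf (free_op X) x = qf X (A *v x) + qf X (Abar *v x)"
  by (simp add: free_op_def qf_add qf_congruence)

definition gain_mat :: "(nat \<Rightarrow> real^'n^'n) \<Rightarrow> real^'m^'m" where
  "gain_mat P = R + transpose B ** P d ** B + transpose Bbar ** P 0 ** Bbar"

lemma gain_of_eq:
  "gain_of d A Abar B Bbar R P =
    matrix_inv (gain_mat P) ** (transpose B ** P d ** A + transpose Bbar ** P 0 ** Abar)"
  by (simp add: gain_of_def gain_mat_def)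

text \<open>Besides invertibility this gives a coercivity bound uniform along the iteration, on
  which convergence of the gains rests.\<close>

lemma gain_mat_ge:
  assumes "qle (\<lambda>_. 0) P"
  shows "qf R x \<le> qf (gain_mat P) x"
proof -
  have "0 \<le> qf (P d) y" "0 \<le> qf (P 0) y" for y
    using assms by (auto simp: qle_def)
  then show ?thesis
    by (simp add: gain_mat_def qf_add qf_congruence)
qed

lemma gain_mat_posdef:
  assumes "symm P" "qle (\<lambda>_. 0) P"
  shows "posdef (gain_mat P)"
  unfolding posdef_qf
proof (intro conjI allI impI)
  show "transpose (gain_mat P) = gain_mat P"
    using assms(1) R by (simp add: gain_mat_def transpose_add symmetric_congruence symm_def posdef_def)
  fix x :: "real^'m" assume "x \<noteq> 0"
  then have "0 < qf R x" using R by (simp add: posdef_qf)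
  with gain_mat_ge[OF assms(2), of x] show "0 < qf (gain_mat P) x" by linarith
qed

lemma gain_mat_mult_gain:
  assumes "symm P" "qle (\<lambda>_. 0) P"
  shows "gain_mat P ** gain_of d A Abar B Bbar R P = transpose B ** P d ** A + transpose Bbar ** P 0 ** Abar"
  unfolding gain_of_eq matrix_mul_assoc[of "gain_mat P"]
  by (simp add: matrix_inv_right_mult posdef_imp_invertible gain_mat_posdef assms)

text \<open>The gain enters only the equation at index \<open>d\<close>, where changing it to the
  new gain drops a nonnegative square.\<close>

lemma gain_supersolution:
  assumes P: "symm P" "qle (\<lambda>_. 0) P" "solves K P"
  shows "qle (lyap_step (gain_of d A Abar B Bbar R P) P) P"
  unfolding qle_def
proof (intro allI impI)
  fix i x assume i: "i \<le> d"
  let ?G = "gain_of d A Abar B Bbar R P"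
  have eq: "P i = lyap_step K P i" using P(3) i by (simp add: solves_def)
  show "qf (lyap_step ?G P i) x \<le> qf (P i) x"
  proof (cases "i < d")
    case True
    have "lyap_step ?G P i = lyap_step K P i"
      using True by (simp add: lyap_step_def lyap_def cost_def drift_def diffusion_def)
    with eq show ?thesis by simp
  next
    case False
    with i have [simp]: "i = d" by simp
    have "0 \<le> qf (gain_mat P) ((K - ?G) *v x)"
      using gain_mat_posdef[OF P(1,2)] unfolding posdef_qf by (metis less_imp_le order.refl qf_zero_vec)
    moreover have "transpose (P 0) = P 0" "transpose (P d) = P d"
      using P(1) by (auto simp: symm_def)
    note lyap_improvement[OF this gain_mat_def gain_mat_mult_gain[OF P(1,2)], of K x]
    ultimately have "qf (lyap_step ?G P d) x \<le> qf (lyap_step K P d) x"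
      by linarith
    with eq show ?thesis by (metis \<open>i = d\<close>)
  qed
qed

end

text \<open>Started at a deterministic \<open>v\<close>, the uncontrolled system has
  \<open>qf ((free_op ^^ k) Q) v\<close> as the expected value of x_k' Q x_k. The assumption is thus
  exact observability tested on deterministic starts at time 0.\<close>

locale observable_lqr = delay_lqr +
  assumes observable: "\<And>v. (\<And>k. qf ((free_op ^^ k) Q) v = 0) \<Longrightarrow> v = 0"
begin

text \<open>In a solution all three summands of \<open>qf (P i) v\<close> are nonnegative, so a zero
  of the form passes to \<open>A *v v\<close> at some index and to \<open>Abar *v v\<close> at index
  0, while \<open>qf Q v\<close> vanishes. Induction on \<open>k\<close> then reaches every
  \<open>free_op ^^ k\<close>.\<close>

lemma solution_posdef:
  assumes P: "symm P" "qle (\<lambda>_. 0) P" "solves K P" and i: "i \<le> d"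
  shows "posdef (P i)"
proof -
  have nonneg: "0 \<le> qf (P i) x" if "i \<le> d" for i x
    using P(2) that by (simp add: qle_def)
  have ker: "qf Q v = 0 \<and> (\<exists>j\<le>d. qf (P j) (A *v v) = 0) \<and> qf (P 0) (Abar *v v) = 0"
    if i: "i \<le> d" and v: "qf (P i) v = 0" for i v
  proof -
    have "P i = lyap_step K P i" using P(3) i by (simp add: solves_def)
    then have sum: "qf (P (min (Suc i) d)) (drift K i *v v) + qf (P 0) (diffusion K i *v v) + qf (cost K i) v = 0"
      using v by (metis qf_lyap qf_lyap_step)
    moreover have "0 \<le> qf (P (min (Suc i) d)) (drift K i *v v)" "0 \<le> qf (P 0) (diffusion K i *v v)"
      "0 \<le> qf (cost K i) v"
      by (auto intro: nonneg qf_cost_nonneg)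
    ultimately have z: "qf (P (min (Suc i) d)) (drift K i *v v) = 0"
      "qf (P 0) (diffusion K i *v v) = 0" "qf (cost K i) v = 0"
      by linarith+
    show ?thesis
    proof (cases "i < d")
      case True
      with z show ?thesis
        by (auto simp: drift_def diffusion_def cost_def intro!: exI[of _ "Suc i"])
    next
      case False
      have "0 \<le> qf Q v" using Q by (simp add: possemidef_qf)
      moreover have Rpos: "0 \<le> qf R y" for y
        using R unfolding posdef_qf by (metis less_imp_le order.refl qf_zero_vec)
      moreover have "qf R (K *v v) + qf Q v = 0"
        using z(3) False by (simp add: cost_def qf_add qf_congruence)
      ultimately have "qf R (K *v v) = 0" "qf Q v = 0"
        using Rpos[of "K *v v"] by linarith+
      \<comment> \<open>Positive definiteness of \<open>R\<close> switches the feedback off at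
        \<open>v\<close>, so the closed-loop matrices act on it as \<open>A\<close> and
        \<open>Abar\<close>.\<close>
      then have "K *v v = 0"
        using R unfolding posdef_qf by (metis less_irrefl)
      with z(1,2) False i \<open>qf Q v = 0\<close> show ?thesis
        by (auto simp: drift_def diffusion_def matrix_vector_mult_diff_rdistrib
            simp flip: matrix_vector_mul_assoc)
    qed
  qed
  have "qf ((free_op ^^ k) Q) v = 0" if "i \<le> d" "qf (P i) v = 0" for k i v
    using that
  proof (induction k arbitrary: i v)
    case (Suc k)
    obtain j where "j \<le> d" "qf (P j) (A *v v) = 0" "qf (P 0) (Abar *v v) = 0"
      using ker[OF Suc.prems] by blast
    with Suc.IH[of j "A *v v"] Suc.IH[of 0 "Abar *v v"] show ?case
      by (simp add: qf_free_op)
  qed (use ker in simp)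
  then have "qf (P i) v \<noteq> 0" if "v \<noteq> 0" for v
    using observable i that by blast
  with nonneg[OF i] have "0 < qf (P i) v" if "v \<noteq> 0" for v
    using that by (simp add: order_less_le)
  with P(1) i show ?thesis
    by (simp add: posdef_qf symm_def)
qed

text \<open>No contraction rate is available from a semidefinite cost; the strict gap comes from
  positive definiteness of P - L, which is a solution because \<open>L\<close> is fixed by
  \<open>lyap K\<close>.\<close>

lemma solution_imp_stable:
  assumes P: "symm P" "qle (\<lambda>_. 0) P" "solves K P"
  shows "stable K"
proof -
  let ?T = "\<lambda>k. (lyap K ^^ k) P"
  have sym: "symm (?T k)" for k by (rule symm_lyap_power[OF P(1)])
  have T_nonneg: "qle (\<lambda>_. 0) (?T k)" for k
  proof (induction k)
    case (Suc k)
    then show ?case by (simp add: qle_def qf_lyap)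
  qed (use P in simp)
  have step: "P i = lyap K P i + cost K i" if "i \<le> d" for i
    using P(3) that by (simp add: solves_def lyap_step_def)
  have "qle (lyap K P) P"
    unfolding qle_def
  proof (intro allI impI)
    fix i x assume "i \<le> d"
    then have "qf (P i) x = qf (lyap K P i) x + qf (cost K i) x"
      using step by (metis qf_add)
    with qf_cost_nonneg[of K i x] show "qf (lyap K P i) x \<le> qf (P i) x" by linarith
  qed
  then have dec: "qle (?T (Suc k)) (?T k)" for k
    using qle_lyap_power[of "lyap K P" P, where K = K and k = k] by (simp add: funpow_swap1)
  have decs: "decseq (\<lambda>k. qf (?T k i) x)" if "i \<le> d" for i x
    using dec that by (intro decseq_SucI) (simp add: qle_def)
  have "\<exists>L. (\<lambda>k. ?T k i) \<longlonglongrightarrow> L \<and> transpose L = L" if i: "i \<le> d" for i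
  proof -
    have "convergent (\<lambda>k. qf (?T k i) x)" for x
    proof -
      have "\<forall>k. 0 \<le> qf (?T k i) x" using T_nonneg i by (auto simp: qle_def)
      then show ?thesis using decseq_convergent[OF decs[OF i]] by (metis convergentI)
    qed
    moreover have "transpose (?T k i) = ?T k i" for k
      using sym i by (auto simp: symm_def)
    ultimately show ?thesis using symmetric_convergent[of "\<lambda>k. ?T k i"] by metis
  qed
  then obtain L where L: "\<And>i. i \<le> d \<Longrightarrow> (\<lambda>k. ?T k i) \<longlonglongrightarrow> L i" "\<And>i. i \<le> d \<Longrightarrow> transpose (L i) = L i"
    by metis
  have LT: "lyap K L i = L i" if i: "i \<le> d" for i
  proof -
    have "(\<lambda>k. ?T (Suc k) i) \<longlonglongrightarrow> lyap K L i"
      by (simp, intro tendsto_lyap L)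
    moreover have "(\<lambda>k. ?T (Suc k) i) \<longlonglongrightarrow> L i"
      using L(1)[OF i] by (rule LIMSEQ_Suc)
    ultimately show ?thesis by (rule LIMSEQ_unique)
  qed
  have LTpow: "(lyap K ^^ k) L i = L i" if "i \<le> d" for k i
    using that
  proof (induction k arbitrary: i)
    case (Suc k)
    have "lyap K ((lyap K ^^ k) L) = lyap K L" by (rule lyap_cong) (rule Suc.IH)
    with LT Suc.prems show ?case by simp
  qed simp
  define P' where "P' i = P i - L i" for i
  have "symm P'"
    using P(1) L(2) by (simp add: symm_def P'_def transpose_diff)
  moreover have "qle (\<lambda>_. 0) P'"
    unfolding qle_def
  proof (intro allI impI)
    fix i x assume i: "i \<le> d"
    have "qf (L i) x \<le> qf (?T 0 i) x"
      by (rule decseq_ge[OF decs[OF i] tendsto_qf[OF L(1)[OF i]]])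
    then show "qf 0 x \<le> qf (P' i) x" by (simp add: P'_def qf_diff)
  qed
  moreover have "solves K P'"
    unfolding solves_def lyap_step_def P'_def lyap_diff using LT step by (simp add: algebra_simps)
  ultimately have "posdef (P' i)" if "i \<le> d" for i
    using solution_posdef that by blast
  \<comment> \<open>Applying \<open>lyap K ^^ k\<close> to P <= c (P - L) leaves \<open>L\<close>
    fixed and bounds \<open>?T k\<close> by c times \<open>?T k\<close> - L, which tends to 0;
    \<open>c'\<close> below compares the identity tuple with \<open>P\<close>.\<close>
  then obtain c where c: "c > 0" "qle P (\<lambda>i. c *\<^sub>R P' i)"
    using tuple_dominated[of P' P] by blast
  obtain c' where c': "c' > 0" "qle (\<lambda>_. mat 1) (\<lambda>i. c' *\<^sub>R P i)"
    using tuple_dominated[of P "\<lambda>_. mat 1"] solution_posdef[OF P] by blast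
  show "stable K"
    unfolding stable_def
  proof (intro allI impI)
    fix i x assume i: "i \<le> d"
    let ?a = "\<lambda>k. qf ((lyap K ^^ k) (\<lambda>_. mat 1) i) x"
    have "(\<lambda>k. qf (?T k i - L i) x) \<longlonglongrightarrow> qf (L i - L i) x"
      by (intro tendsto_intros L i)
    then have lim: "(\<lambda>k. c' * (c * qf (?T k i - L i) x)) \<longlonglongrightarrow> 0"
      by (auto intro!: tendsto_mult_right_zero)
    have "0 \<le> ?a k" for k
      using i by (induction k arbitrary: i x) (auto simp: qf_mat1 qf_lyap)
    moreover have "?a k \<le> c' * (c * qf (?T k i - L i) x)" for k
    proof -
      have "?a k \<le> c' * qf (?T k i) x"
        using qle_lyap_power[OF c'(2), where K = K and k = k] i
        unfolding lyap_power_scaleR by (simp add: qle_def qf_scaleR)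
      moreover have "qf (?T k i) x \<le> c * qf (?T k i - L i) x"
        using qle_lyap_power[OF c(2), where K = K and k = k] i
        unfolding lyap_power_scaleR P'_def lyap_power_diff by (simp add: qle_def qf_scaleR LTpow)
      ultimately show ?thesis using c'(1) by (meson mult_left_mono less_imp_le order_trans)
    qed
    ultimately show "?a \<longlonglongrightarrow> 0"
      by (intro tendsto_sandwich[OF _ _ tendsto_const lim] always_eventually) auto
  qed
qed

end

section \<open>Convergence of policy iteration\<close>

lemma matrix_tendstoI:
  fixes S :: "nat \<Rightarrow> real^'n^'m"
  assumes "\<And>x. (\<lambda>n. S n *v x) \<longlonglongrightarrow> L *v x"
  shows "S \<longlonglongrightarrow> L"
proof (intro vec_tendstoI)
  fix i j
  have "(\<lambda>n. axis i 1 \<bullet> (S n *v axis j 1)) \<longlonglongrightarrow> axis i 1 \<bullet> (L *v axis j 1)"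
    by (intro tendsto_intros assms)
  then show "(\<lambda>n. S n $ i $ j) \<longlonglongrightarrow> L $ i $ j"
    by (simp flip: matrix_nth_inner)
qed

text \<open>A lower bound on the quadratic forms of the matrices \<open>S n\<close> bounds their inverses.\<close>

lemma coercive_solution_tendsto:
  fixes S :: "nat \<Rightarrow> real^'m^'m" and X :: "nat \<Rightarrow> real^'n^'m"
  assumes r: "r > 0" "\<And>n x. r * (norm x)\<^sup>2 \<le> qf (S n) x"
    and S: "S \<longlonglongrightarrow> S'" and Y: "(\<lambda>n. S n ** X n) \<longlonglongrightarrow> S' ** X'"
  shows "X \<longlonglongrightarrow> X'"
proof (rule matrix_tendstoI)
  fix x
  have inv: "norm y \<le> norm (S n *v y) / r" for n y
  proof (cases "y = 0")
    case False
    have "r * (norm y)\<^sup>2 \<le> norm y * norm (S n *v y)"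
      using r(2)[of y n] norm_cauchy_schwarz[of y "S n *v y"] by (simp add: qf_def)
    with False have "r * norm y \<le> norm (S n *v y)"
      by (simp add: power2_eq_square mult.left_commute[of r])
    then show ?thesis using r(1) by (simp add: field_simps)
  qed (use r in simp)
  have "(\<lambda>n. norm ((S n ** X n) *v x - (S n ** X') *v x) / r)
      \<longlonglongrightarrow> norm ((S' ** X') *v x - (S' ** X') *v x) / r"
    using r(1) by (intro tendsto_intros S Y) auto
  then have lim: "(\<lambda>n. norm ((S n ** X n) *v x - (S n ** X') *v x) / r) \<longlonglongrightarrow> 0"
    by simp
  have "norm (X n *v x - X' *v x) \<le> norm ((S n ** X n) *v x - (S n ** X') *v x) / r" for n
    using inv[of "X n *v x - X' *v x" n]
    by (simp add: matrix_vector_mult_diff_distrib matrix_vector_mul_assoc)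
  then have "(\<lambda>n. X n *v x - X' *v x) \<longlonglongrightarrow> 0"
    by (intro Lim_null_comparison[OF always_eventually lim]) auto
  then show "(\<lambda>n. X n *v x) \<longlonglongrightarrow> X' *v x"
    by (rule LIM_zero_cancel)
qed

context observable_lqr
begin

text \<open>Observability upgrades semidefinite solutions to definite ones, so the arguments can use
  nonnegativity, a condition that survives limits.\<close>

lemma posdef_lyapunov_solution_iff:
  "posdef_lyapunov_solution d A Abar B Bbar Q R K P \<longleftrightarrow> symm P \<and> qle (\<lambda>_. 0) P \<and> solves K P"
proof
  assume L: "posdef_lyapunov_solution d A Abar B Bbar Q R K P"
  then have "solves K P" and pd: "\<And>i. i \<le> d \<Longrightarrow> posdef (P i)"
    by (auto simp: posdef_lyapunov_solution_def lyapunov_eqs_iff_solves)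
  moreover have "symm P" using pd by (simp add: symm_def posdef_qf)
  moreover have "qle (\<lambda>_. 0) P"
    using pd unfolding qle_def posdef_qf qf_zero by (metis less_imp_le order.refl qf_zero_vec)
  ultimately show "symm P \<and> qle (\<lambda>_. 0) P \<and> solves K P" by blast
next
  assume "symm P \<and> qle (\<lambda>_. 0) P \<and> solves K P"
  then show "posdef_lyapunov_solution d A Abar B Bbar Q R K P"
    using solution_posdef by (auto simp: posdef_lyapunov_solution_def lyapunov_eqs_iff_solves)
qed

text \<open>\<open>P\<close> itself is the supersolution for the new gain; stability of that gain
  then follows from its having a solution at all.\<close>

lemma policy_improvement:
  assumes P: "symm P" "qle (\<lambda>_. 0) P" "solves K P"
  defines "G \<equiv> gain_of d A Abar B Bbar R P"
  obtains P' where "symm P'" "qle (\<lambda>_. 0) P'" "qle P' P" "solves G P'" "stable G"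
proof -
  obtain P' where P': "symm P'" "qle (\<lambda>_. 0) P'" "qle P' P" "solves G P'"
    using minimal_solution[OF P(1,2) gain_supersolution[OF P]] unfolding G_def by blast
  with solution_imp_stable that show thesis by blast
qed

text \<open>The gains solve linear equations whose data converge and whose matrices are uniformly
  bounded below by \<open>R\<close>; continuity of the matrix inverse is not invoked.\<close>

lemma gain_of_tendsto:
  assumes P: "\<And>j. symm (P j)" "\<And>j. qle (\<lambda>_. 0) (P j)"
    and L: "symm L" "qle (\<lambda>_. 0) L" "\<And>i. i \<le> d \<Longrightarrow> (\<lambda>j. P j i) \<longlonglongrightarrow> L i"
  shows "(\<lambda>j. gain_of d A Abar B Bbar R (P j)) \<longlonglongrightarrow> gain_of d A Abar B Bbar R L"
proof -
  obtain r :: real where r: "r > 0" "\<And>x. r * (norm x)\<^sup>2 \<le> qf R x"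
    using posdef_coercive R by metis
  show ?thesis
  proof (rule coercive_solution_tendsto[OF r(1)])
    show "r * (norm x)\<^sup>2 \<le> qf (gain_mat (P n)) x" for n x
      using r(2) gain_mat_ge[OF P(2)] by (meson order_trans)
    show "(\<lambda>n. gain_mat (P n)) \<longlonglongrightarrow> gain_mat L"
      unfolding gain_mat_def by (intro tendsto_intros L(3)) auto
    show "(\<lambda>n. gain_mat (P n) ** gain_of d A Abar B Bbar R (P n))
        \<longlonglongrightarrow> gain_mat L ** gain_of d A Abar B Bbar R L"
      unfolding gain_mat_mult_gain[OF P] gain_mat_mult_gain[OF L(1,2)]
      by (intro tendsto_intros L(3)) auto
  qed
qed

lemma lyap_step_tendsto:
  assumes "K \<longlonglongrightarrow> K'" "\<And>i. i \<le> d \<Longrightarrow> (\<lambda>j. P j i) \<longlonglongrightarrow> L i"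
  shows "(\<lambda>j. lyap_step (K j) (P j) i) \<longlonglongrightarrow> lyap_step K' L i"
proof (cases "i < d")
  case True
  then show ?thesis
    unfolding lyap_step_def lyap_def cost_def drift_def diffusion_def if_P[OF True]
    by (intro tendsto_intros assms) auto
next
  case False
  then show ?thesis
    unfolding lyap_step_def lyap_def cost_def drift_def diffusion_def if_not_P[OF False]
    by (intro tendsto_intros assms) auto
qed

theorem policy_iteration_exists:
  assumes "stable K0"
  shows "\<exists>P K. policy_iteration d A Abar B Bbar Q R K0 P K"
proof -
  have "\<exists>P. stable K \<longrightarrow> symm P \<and> qle (\<lambda>_. 0) P \<and> solves K P" for K
    using stable_imp_solution by blast
  \<comment> \<open>Choosing solutions for all gains at once makes the sequence of gains an orbit of
    a single map; \<open>sol\<close> is meaningful at stable gains.\<close>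
  then obtain sol where sol: "\<And>K. stable K \<Longrightarrow> symm (sol K)"
    "\<And>K. stable K \<Longrightarrow> qle (\<lambda>_. 0) (sol K)" "\<And>K. stable K \<Longrightarrow> solves K (sol K)"
    by metis
  define K where "K j = ((\<lambda>K. gain_of d A Abar B Bbar R (sol K)) ^^ j) K0" for j
  have K: "K 0 = K0" "K (Suc j) = gain_of d A Abar B Bbar R (sol (K j))" for j
    by (simp_all add: K_def)
  have "stable (K j)" for j
  proof (induction j)
    case (Suc j)
    show ?case
      unfolding K by (rule policy_improvement[OF sol[OF Suc.IH]])
  qed (use assms K in simp)
  then have "policy_iteration d A Abar B Bbar Q R K0 (\<lambda>j. sol (K j)) K"
    unfolding policy_iteration_def posdef_lyapunov_solution_iff using K sol by blast
  then show ?thesis by blast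
qed

section \<open>Monotonicity and limit of the iterates\<close>

context
  fixes K0 P K
  assumes pi: "policy_iteration d A Abar B Bbar Q R K0 P K"
begin

lemma iterate_solution: "symm (P j)" "qle (\<lambda>_. 0) (P j)" "solves (K j) (P j)"
  using pi by (auto simp: policy_iteration_def posdef_lyapunov_solution_iff)

lemma iterate_gain: "K (Suc j) = gain_of d A Abar B Bbar R (P j)"
  using pi by (simp add: policy_iteration_def)

lemma iterate_stable: "stable (K j)"
  by (rule solution_imp_stable) (rule iterate_solution)+

lemma iterate_unique:
  assumes "posdef_lyapunov_solution d A Abar B Bbar Q R (K j) P'" "i \<le> d"
  shows "P' i = P j i"
  using assms stable_unique_solution[OF iterate_stable _ _ iterate_solution(1,3)]
  unfolding posdef_lyapunov_solution_iff by blast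

text \<open>Policy improvement yields some solution below \<open>P j\<close>; uniqueness for the
  stable gain \<open>K (Suc j)\<close> identifies it with \<open>P (Suc j)\<close>.\<close>

lemma iterate_decreasing: "qle (P (Suc j)) (P j)"
proof -
  obtain P' where P': "symm P'" "qle P' (P j)" "solves (K (Suc j)) P'"
    using policy_improvement[OF iterate_solution] unfolding iterate_gain by metis
  have "P' i = P (Suc j) i" if "i \<le> d" for i
    by (rule stable_unique_solution[OF iterate_stable P'(1,3) iterate_solution(1,3) that])
  with P'(2) show ?thesis by (simp add: qle_def)
qed

lemma iterate_loewner:
  assumes "i \<le> d"
  shows "posdef (P (Suc j) i)" "loewner_le (P (Suc j) i) (P j i)"
  using solution_posdef[OF iterate_solution assms] assms iterate_decreasing[of j]
    iterate_solution(1)[of j] iterate_solution(1)[of "Suc j"]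
  by (auto simp: loewner_le_def possemidef_qf transpose_diff qf_diff qle_def symm_def)

lemma iterate_limit:
  "\<exists>Plim Klim. (\<forall>i\<le>d. (\<lambda>j. P j i) \<longlonglongrightarrow> Plim i) \<and> K \<longlonglongrightarrow> Klim \<and>
     lyapunov_eqs d A Abar B Bbar Q R Klim Plim \<and> Klim = gain_of d A Abar B Bbar R Plim"
proof -
  have "\<exists>L. (\<lambda>j. P j i) \<longlonglongrightarrow> L \<and> transpose L = L \<and> (\<forall>x. 0 \<le> qf L x)" if i: "i \<le> d" for i
  proof -
    have dec: "decseq (\<lambda>j. qf (P j i) x)" for x
      using iterate_decreasing i by (intro decseq_SucI) (simp add: qle_def)
    have nn: "0 \<le> qf (P j i) x" for j x
      using iterate_solution(2) i by (simp add: qle_def)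
    have "convergent (\<lambda>j. qf (P j i) x)" for x
      using decseq_convergent[OF dec] nn by (metis convergentI)
    moreover have "transpose (P j i) = P j i" for j
      using iterate_solution(1) i by (simp add: symm_def)
    ultimately obtain L where L: "(\<lambda>j. P j i) \<longlonglongrightarrow> L" "transpose L = L"
      using symmetric_convergent[of "\<lambda>j. P j i"] by metis
    have "0 \<le> qf L x" for x
      using LIMSEQ_le_const[OF tendsto_qf[OF L(1)]] nn by blast
    with L show ?thesis by blast
  qed
  then obtain L where L: "\<And>i. i \<le> d \<Longrightarrow> (\<lambda>j. P j i) \<longlonglongrightarrow> L i"
    "\<And>i. i \<le> d \<Longrightarrow> transpose (L i) = L i" "\<And>i x. i \<le> d \<Longrightarrow> 0 \<le> qf (L i) x"
    by metis
  let ?G = "gain_of d A Abar B Bbar R L"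
  \<comment> \<open>The gain formula covers the indices from 1 on; \<open>K 0\<close> is the
    arbitrary initial gain.\<close>
  have "(\<lambda>j. K (Suc j)) \<longlonglongrightarrow> ?G"
    unfolding iterate_gain using L iterate_solution
    by (intro gain_of_tendsto) (auto simp: symm_def qle_def)
  then have K: "K \<longlonglongrightarrow> ?G" by (rule LIMSEQ_imp_Suc)
  have "solves ?G L"
    unfolding solves_def
  proof (intro allI impI)
    fix i assume i: "i \<le> d"
    have "(\<lambda>j. P j i) \<longlonglongrightarrow> lyap_step ?G L i"
      using lyap_step_tendsto[OF K L(1), where i = i] iterate_solution(3) i
      by (simp add: solves_def)
    with L(1)[OF i] show "L i = lyap_step ?G L i" using LIMSEQ_unique by blast
  qed
  with K L(1) show ?thesis
    unfolding lyapunov_eqs_iff_solves by blast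
qed

end

end

section \<open>Square-integrable processes driven by white noise\<close>

definition L2 :: "'a measure \<Rightarrow> 'a measure \<Rightarrow> ('a \<Rightarrow> 'b::euclidean_space) \<Rightarrow> bool" where
  "L2 M G f \<longleftrightarrow> f \<in> borel_measurable G \<and> integrable M (\<lambda>\<omega>. (norm (f \<omega>))\<^sup>2)"

lemma matrix_vector_mult_borel [measurable]: "(*v) P \<in> borel_measurable borel"
  for P :: "real^'n^'m"
  by (intro borel_measurable_continuous_onI matrix_vector_mult_linear_continuous_on)

locale white_noise_space = prob_space M for M :: "'a measure" +
  fixes w :: "nat \<Rightarrow> 'a \<Rightarrow> real"
  assumes white_noise: "white_noise M w"
begin

abbreviation past :: "int \<Rightarrow> 'a measure" where
  "past \<equiv> noise_filtration M w"

lemma noise_measurable [measurable]: "w k \<in> borel_measurable M"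
  using white_noise by (auto simp: white_noise_def indep_vars_def)

lemma noise_square_integrable: "integrable M (\<lambda>\<omega>. (w k \<omega>)\<^sup>2)"
  and noise_mean: "expectation (w k) = 0"
  and noise_variance: "expectation (\<lambda>\<omega>. (w k \<omega>)\<^sup>2) = 1"
  using white_noise by (auto simp: white_noise_def power2_eq_square)

lemma noise_integrable: "integrable M (w k)"
  by (rule square_integrable_imp_integrable[OF noise_measurable noise_square_integrable])

lemma space_past [simp]: "space (past m) = space M"
  by (simp add: noise_filtration_def space_measure_of_conv)

lemma sets_past: "sets (past m) = sigma_sets (space M) {w i -` S \<inter> space M | i S. int i \<le> m \<and> S \<in> sets borel}"
  unfolding noise_filtration_def by (intro sets_measure_of) auto

lemma sets_past_subset: "sets (past m) \<subseteq> sets M"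
  unfolding sets_past by (intro sets.sigma_sets_subset) (auto intro: measurable_sets)

lemma past_subalgebra: "subalgebra M (past m)"
  by (simp add: subalgebra_def sets_past_subset)

lemma past_mono:
  assumes "m \<le> m'"
  shows "subalgebra (past m') (past m)"
proof -
  have "{w i -` S \<inter> space M | i S. int i \<le> m \<and> S \<in> sets borel}
      \<subseteq> {w i -` S \<inter> space M | i S. int i \<le> m' \<and> S \<in> sets borel}"
    using order_trans[OF _ assms] by blast
  then show ?thesis
    unfolding subalgebra_def sets_past by (simp add: sigma_sets_mono')
qed

lemma past_sigma_finite: "sigma_finite_subalgebra M (past m)"
  by (rule finite_measure_subalgebra_is_sigma_finite)
    (simp add: finite_measure_subalgebra_def finite_measure_subalgebra_axioms_def past_subalgebra
      finite_measure_axioms)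

lemma noise_past_measurable:
  assumes "int k \<le> m"
  shows "w k \<in> borel_measurable (past m)"
proof (rule measurableI)
  fix S :: "real set" assume "S \<in> sets borel"
  with assms show "w k -` S \<inter> space (past m) \<in> sets (past m)"
    unfolding sets_past space_past by (intro sigma_sets.Basic) blast
qed simp

text \<open>Sigma-algebras generated by disjoint groups of independent variables are independent;
  the groups are \<open>w l\<close> alone and all \<open>w i\<close> up to time
  \<open>m\<close>.\<close>

lemma noise_indep_past:
  fixes h :: "'a \<Rightarrow> real"
  assumes m: "m < int l" and h: "h \<in> borel_measurable (past m)"
  shows "indep_var borel (w l) borel h"
proof -
  let ?E = "\<lambda>i. {w i -` S \<inter> space M | S. S \<in> sets borel}"
  \<comment> \<open>For negative \<open>m\<close> the second group is empty and its sigma-algebra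
    trivial, as the filtration demands.\<close>
  let ?I = "case_bool {l} {i. int i \<le> m}"
  have "indep_sets ?E UNIV"
    using white_noise by (auto simp: white_noise_def indep_vars_def2)
  then have "indep_sets ?E (\<Union>b\<in>UNIV. ?I b)"
    by (rule indep_sets_mono_index[rotated]) simp
  then have "indep_sets (\<lambda>b. sigma_sets (space M) (\<Union>i\<in>?I b. ?E i)) UNIV"
  proof (rule indep_sets_collect_sigma)
    show "Int_stable (?E i)" for i
    proof (rule Int_stableI)
      fix a b assume "a \<in> ?E i" "b \<in> ?E i"
      then obtain S T where "a = w i -` S \<inter> space M" "b = w i -` T \<inter> space M" "S \<in> sets borel" "T \<in> sets borel"
        by blast
      then have "a \<inter> b = w i -` (S \<inter> T) \<inter> space M" "S \<inter> T \<in> sets borel" by auto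
      then show "a \<inter> b \<in> ?E i" by blast
    qed
    show "disjoint_family_on ?I UNIV"
      using m by (auto simp: disjoint_family_on_def split: bool.splits)
  qed
  then have "indep_sets (case_bool (sigma_sets (space M) (?E l))
      (sigma_sets (space M) {h -` S \<inter> space M | S. S \<in> sets borel})) UNIV"
  proof (rule indep_sets_mono_sets)
    fix b :: bool
    have "sigma_sets (space M) {h -` S \<inter> space M | S. S \<in> sets borel} \<subseteq> sets (past m)"
      using h measurable_sets[OF h] by (intro sets.sigma_sets_subset[of _ "past m", simplified]) auto
    also have "sets (past m) = sigma_sets (space M) (\<Union>i\<in>{i. int i \<le> m}. ?E i)"
      unfolding sets_past by (rule arg_cong[where f = "sigma_sets _"]) blast
    finally show "case_bool (sigma_sets (space M) (?E l))
        (sigma_sets (space M) {h -` S \<inter> space M | S. S \<in> sets borel}) b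
      \<subseteq> sigma_sets (space M) (\<Union>i\<in>?I b. ?E i)"
      by (cases b) auto
  qed
  moreover have "h \<in> borel_measurable M"
    using h measurable_from_subalg past_subalgebra by blast
  ultimately show ?thesis
    by (simp add: indep_var_eq indep_set_def)
qed

lemma noise_product:
  fixes h :: "'a \<Rightarrow> real"
  assumes m: "m < int l" and h: "h \<in> borel_measurable (past m)" "integrable M h"
  shows "expectation (\<lambda>\<omega>. w l \<omega> * h \<omega>) = 0"
    and "integrable M (\<lambda>\<omega>. (w l \<omega>)\<^sup>2 * h \<omega>)"
    and "expectation (\<lambda>\<omega>. (w l \<omega>)\<^sup>2 * h \<omega>) = expectation h"
proof -
  note ind = noise_indep_past[OF m h(1)]
  show "expectation (\<lambda>\<omega>. w l \<omega> * h \<omega>) = 0"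
    using indep_var_lebesgue_integral[OF ind noise_integrable h(2)] by (simp add: noise_mean)
  have "indep_var borel ((\<lambda>x. x\<^sup>2) \<circ> w l) borel ((\<lambda>x. x) \<circ> h)"
    by (rule indep_var_compose[OF ind]) auto
  then have ind2: "indep_var borel (\<lambda>\<omega>. (w l \<omega>)\<^sup>2) borel h"
    by (simp add: comp_def)
  show "integrable M (\<lambda>\<omega>. (w l \<omega>)\<^sup>2 * h \<omega>)"
    by (rule indep_var_integrable[OF ind2 noise_square_integrable h(2)])
  show "expectation (\<lambda>\<omega>. (w l \<omega>)\<^sup>2 * h \<omega>) = expectation h"
    using indep_var_lebesgue_integral[OF ind2 noise_square_integrable h(2)] by (simp add: noise_variance)
qed

section \<open>Calculus of square-integrable random vectors\<close>

lemma L2_const: "L2 M G (\<lambda>_. c)"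
  by (simp add: L2_def)

lemma L2_cong:
  assumes "\<And>\<omega>. \<omega> \<in> space M \<Longrightarrow> f \<omega> = g \<omega>" "space G = space M" "L2 M G f"
  shows "L2 M G g"
proof -
  have "integrable M (\<lambda>\<omega>. (norm (f \<omega>))\<^sup>2) \<longleftrightarrow> integrable M (\<lambda>\<omega>. (norm (g \<omega>))\<^sup>2)"
    using assms(1) by (intro Bochner_Integration.integrable_cong) auto
  moreover have "f \<in> borel_measurable G \<longleftrightarrow> g \<in> borel_measurable G"
    using assms(1,2) by (intro measurable_cong) auto
  ultimately show ?thesis using assms(3) by (simp add: L2_def)
qed

lemma L2_subalg: "subalgebra G G' \<Longrightarrow> L2 M G' f \<Longrightarrow> L2 M G f"
  unfolding L2_def using measurable_from_subalg by blast

lemma L2_past_mono: "m \<le> m' \<Longrightarrow> L2 M (past m) f \<Longrightarrow> L2 M (past m') f"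
  using L2_subalg past_mono by blast

lemma L2_past: "L2 M (past m) f \<Longrightarrow> L2 M M f"
  using L2_subalg past_subalgebra by blast

lemma L2_dominated:
  assumes "f \<in> borel_measurable G" "L2 M G g" "subalgebra M G" "\<And>\<omega>. norm (f \<omega>) \<le> c * norm (g \<omega>)"
  shows "L2 M G f"
  unfolding L2_def
proof (intro conjI assms(1))
  have [measurable]: "f \<in> borel_measurable M"
    using assms measurable_from_subalg by blast
  have "integrable M (\<lambda>\<omega>. c\<^sup>2 * (norm (g \<omega>))\<^sup>2)"
    using assms(2) by (simp add: L2_def)
  then show "integrable M (\<lambda>\<omega>. (norm (f \<omega>))\<^sup>2)"
  proof (rule Bochner_Integration.integrable_bound)
    show "AE \<omega> in M. norm ((norm (f \<omega>))\<^sup>2) \<le> norm (c\<^sup>2 * (norm (g \<omega>))\<^sup>2)"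
      using power_mono[OF assms(4) norm_ge_zero, where n = 2] by (simp add: power_mult_distrib)
  qed simp
qed

lemma L2_matrix:
  fixes P :: "real^'n^'m"
  assumes "L2 M G f" "subalgebra M G"
  shows "L2 M G (\<lambda>\<omega>. P *v f \<omega>)"
proof (rule L2_dominated[OF _ assms])
  show "(\<lambda>\<omega>. P *v f \<omega>) \<in> borel_measurable G"
    using assms(1) matrix_vector_mult_borel[of P] unfolding L2_def by (blast intro: measurable_compose)
  show "norm (P *v f \<omega>) \<le> onorm ((*v) P) * norm (f \<omega>)" for \<omega>
    by (intro onorm matrix_vector_mul_bounded_linear)
qed

lemma L2_add:
  assumes "L2 M G f" "L2 M G g" "subalgebra M G"
  shows "L2 M G (\<lambda>\<omega>. f \<omega> + g \<omega>)"
  unfolding L2_def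
proof
  show meas: "(\<lambda>\<omega>. f \<omega> + g \<omega>) \<in> borel_measurable G"
    using assms by (auto simp: L2_def)
  have [measurable]: "(\<lambda>\<omega>. f \<omega> + g \<omega>) \<in> borel_measurable M"
    using meas assms(3) measurable_from_subalg by blast
  have "integrable M (\<lambda>\<omega>. 2 * (norm (f \<omega>))\<^sup>2 + 2 * (norm (g \<omega>))\<^sup>2)"
    using assms by (simp add: L2_def)
  then show "integrable M (\<lambda>\<omega>. (norm (f \<omega> + g \<omega>))\<^sup>2)"
  proof (rule Bochner_Integration.integrable_bound)
    have "(norm (f \<omega> + g \<omega>))\<^sup>2 \<le> 2 * (norm (f \<omega>))\<^sup>2 + 2 * (norm (g \<omega>))\<^sup>2" for \<omega>
    proof -
      have "(norm (f \<omega> + g \<omega>))\<^sup>2 \<le> (norm (f \<omega>) + norm (g \<omega>))\<^sup>2"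
        by (intro power_mono norm_triangle_ineq) simp
      also have "\<dots> \<le> 2 * (norm (f \<omega>))\<^sup>2 + 2 * (norm (g \<omega>))\<^sup>2"
        using sum_squares_bound[of "norm (f \<omega>)" "norm (g \<omega>)"] by (simp add: power2_sum)
      finally show ?thesis .
    qed
    then show "AE \<omega> in M. norm ((norm (f \<omega> + g \<omega>))\<^sup>2) \<le> norm (2 * (norm (f \<omega>))\<^sup>2 + 2 * (norm (g \<omega>))\<^sup>2)"
      by simp
  qed simp
qed

lemma L2_sum:
  assumes "\<And>i. i \<in> I \<Longrightarrow> L2 M G (f i)" "subalgebra M G"
  shows "L2 M G (\<lambda>\<omega>. \<Sum>i\<in>I. f i \<omega>)"
  using assms(1)
proof (induction I rule: infinite_finite_induct)
  case (insert i I)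
  then show ?case
    using L2_add[of G "f i" "\<lambda>\<omega>. \<Sum>i\<in>I. f i \<omega>"] assms(2) by simp
qed (auto simp: L2_const)

lemma L2_inner_integrable:
  assumes "L2 M M f" "L2 M M g"
  shows "integrable M (\<lambda>\<omega>. f \<omega> \<bullet> g \<omega>)"
proof (rule Bochner_Integration.integrable_bound)
  show "integrable M (\<lambda>\<omega>. (norm (f \<omega>))\<^sup>2 + (norm (g \<omega>))\<^sup>2)"
    using assms by (simp add: L2_def)
  show "(\<lambda>\<omega>. f \<omega> \<bullet> g \<omega>) \<in> borel_measurable M"
    using assms by (auto simp: L2_def)
  have "\<bar>f \<omega> \<bullet> g \<omega>\<bar> \<le> (norm (f \<omega>))\<^sup>2 + (norm (g \<omega>))\<^sup>2" for \<omega>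
  proof -
    have "\<bar>f \<omega> \<bullet> g \<omega>\<bar> \<le> norm (f \<omega>) * norm (g \<omega>)" by (rule Cauchy_Schwarz_ineq2)
    also have "\<dots> \<le> 2 * norm (f \<omega>) * norm (g \<omega>)" by simp
    also have "\<dots> \<le> (norm (f \<omega>))\<^sup>2 + (norm (g \<omega>))\<^sup>2" by (rule sum_squares_bound)
    finally show ?thesis .
  qed
  then show "AE \<omega> in M. norm (f \<omega> \<bullet> g \<omega>) \<le> norm ((norm (f \<omega>))\<^sup>2 + (norm (g \<omega>))\<^sup>2)"
    by simp
qed

lemma L2_qf_integrable:
  assumes "L2 M M f"
  shows "integrable M (\<lambda>\<omega>. qf P (f \<omega>))"
  unfolding qf_def
  by (intro L2_inner_integrable L2_matrix assms) (simp add: subalgebra_def)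

lemma L2_past_inner:
  assumes "L2 M (past m) f" "L2 M (past m) g"
  shows "(\<lambda>\<omega>. f \<omega> \<bullet> g \<omega>) \<in> borel_measurable (past m)" "integrable M (\<lambda>\<omega>. f \<omega> \<bullet> g \<omega>)"
  using assms L2_inner_integrable[OF assms[THEN L2_past]] by (auto simp: L2_def)

text \<open>A product of square-integrable functions need not be square integrable; here
  independence of \<open>w k\<close> from the past factorises the second moment.\<close>

lemma L2_noise:
  assumes "L2 M (past (int k - 1)) f"
  shows "L2 M (past (int k)) (\<lambda>\<omega>. w k \<omega> *\<^sub>R f \<omega>)"
  unfolding L2_def
proof
  have [measurable]: "f \<in> borel_measurable (past (int k))"
    using L2_past_mono[OF _ assms, of "int k"] by (simp add: L2_def)
  have [measurable]: "w k \<in> borel_measurable (past (int k))"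
    by (rule noise_past_measurable) simp
  show "(\<lambda>\<omega>. w k \<omega> *\<^sub>R f \<omega>) \<in> borel_measurable (past (int k))"
    by simp
  have "(\<lambda>\<omega>. (norm (f \<omega>))\<^sup>2) \<in> borel_measurable (past (int k - 1))"
    using L2_past_inner(1)[OF assms assms] by (simp add: power2_norm_eq_inner)
  then have "integrable M (\<lambda>\<omega>. (w k \<omega>)\<^sup>2 * (norm (f \<omega>))\<^sup>2)"
    using assms unfolding L2_def by (intro noise_product(2)) auto
  then show "integrable M (\<lambda>\<omega>. (norm (w k \<omega> *\<^sub>R f \<omega>))\<^sup>2)"
    by (simp add: power_mult_distrib)
qed

lemma noise_orthogonal:
  assumes "L2 M (past (int k - 1)) f" "L2 M (past (int k - 1)) h"
  shows "expectation (\<lambda>\<omega>. (w k \<omega> *\<^sub>R f \<omega>) \<bullet> h \<omega>) = 0"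
  using noise_product(1)[OF _ L2_past_inner[OF assms], of k] by simp

lemma noise_qf:
  assumes "L2 M (past (int k - 1)) f"
  shows "expectation (\<lambda>\<omega>. qf P (w k \<omega> *\<^sub>R f \<omega>)) = expectation (\<lambda>\<omega>. qf P (f \<omega>))"
  using noise_product(3)[OF _ L2_past_inner[OF assms L2_matrix[OF assms past_subalgebra]], of k P]
  by (simp add: qf_scaleR_vec) (simp add: qf_def)

text \<open>As \<open>P\<close> may be asymmetric, the cross terms involve both \<open>P\<close> and
  its transpose; orthogonality is therefore asked for every matrix \<open>C\<close>.\<close>

lemma expectation_qf_add:
  assumes "L2 M M f" "L2 M M g" "\<And>C. expectation (\<lambda>\<omega>. f \<omega> \<bullet> (C *v g \<omega>)) = 0"
  shows "expectation (\<lambda>\<omega>. qf P (f \<omega> + g \<omega>)) = expectation (\<lambda>\<omega>. qf P (f \<omega>)) + expectation (\<lambda>\<omega>. qf P (g \<omega>))"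
proof -
  have "subalgebra M M" by (simp add: subalgebra_def)
  then have int: "integrable M (\<lambda>\<omega>. qf P (f \<omega>))" "integrable M (\<lambda>\<omega>. qf P (g \<omega>))"
    "integrable M (\<lambda>\<omega>. f \<omega> \<bullet> (C *v g \<omega>))" for C
    by (intro L2_qf_integrable L2_inner_integrable L2_matrix assms)+
  have eq: "qf P (f \<omega> + g \<omega>)
      = qf P (f \<omega>) + qf P (g \<omega>) + (f \<omega> \<bullet> (P *v g \<omega>) + f \<omega> \<bullet> (transpose P *v g \<omega>))" for \<omega>
    using inner_matrix_vector_left[of P "f \<omega>" "g \<omega>"]
    by (simp add: qf_def matrix_vector_right_distrib inner_add_left inner_add_right inner_commute
        del: transpose_matrix_vector)
  show ?thesis
    unfolding eq using int assms(3) by (simp del: transpose_matrix_vector)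
qed

lemma expectation_qf_sum:
  assumes "finite I" "\<And>i. i \<in> I \<Longrightarrow> L2 M M (f i)"
    "\<And>i j C. i \<in> I \<Longrightarrow> j \<in> I \<Longrightarrow> i \<noteq> j \<Longrightarrow> expectation (\<lambda>\<omega>. f i \<omega> \<bullet> (C *v f j \<omega>)) = 0"
  shows "expectation (\<lambda>\<omega>. qf P (\<Sum>i\<in>I. f i \<omega>)) = (\<Sum>i\<in>I. expectation (\<lambda>\<omega>. qf P (f i \<omega>)))"
  using assms
proof (induction I rule: finite_induct)
  case (insert i I)
  have sub: "subalgebra M M" by (simp add: subalgebra_def)
  have "expectation (\<lambda>\<omega>. qf P (f i \<omega> + (\<Sum>i\<in>I. f i \<omega>)))
      = expectation (\<lambda>\<omega>. qf P (f i \<omega>)) + expectation (\<lambda>\<omega>. qf P (\<Sum>i\<in>I. f i \<omega>))"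
  proof (rule expectation_qf_add)
    show "L2 M M (f i)" using insert.prems by simp
    show "L2 M M (\<lambda>\<omega>. \<Sum>i\<in>I. f i \<omega>)" using insert.prems by (intro L2_sum sub) simp
    fix C
    have "expectation (\<lambda>\<omega>. f i \<omega> \<bullet> (C *v (\<Sum>j\<in>I. f j \<omega>)))
        = expectation (\<lambda>\<omega>. \<Sum>j\<in>I. f i \<omega> \<bullet> (C *v f j \<omega>))"
      by (simp add: linear_sum[OF matrix_vector_mul_linear] inner_sum_right)
    also have "\<dots> = (\<Sum>j\<in>I. expectation (\<lambda>\<omega>. f i \<omega> \<bullet> (C *v f j \<omega>)))"
      using insert.prems(1) by (intro Bochner_Integration.integral_sum L2_inner_integrable L2_matrix sub) auto
    also have "\<dots> = 0"
      using insert by (intro sum.neutral ballI) (metis insertI1 insertI2)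
    finally show "expectation (\<lambda>\<omega>. f i \<omega> \<bullet> (C *v (\<Sum>j\<in>I. f j \<omega>))) = 0" .
  qed
  with insert show ?case by simp
qed simp

end

section \<open>Orthogonal decomposition of the delayed state\<close>

locale trajectory = white_noise_space M w + delay_lqr d A Abar B Bbar Q R
  for M :: "'a measure" and w and d and A Abar :: "real^'n^'n" and B Bbar :: "real^'m^'n" and Q R +
  fixes x :: "nat \<Rightarrow> 'a \<Rightarrow> real^'n" and v :: "nat \<Rightarrow> 'a \<Rightarrow> real^'m" and x0 :: "real^'n"
  assumes d_pos: "1 \<le> d"
    and x_0: "\<And>\<omega>. \<omega> \<in> space M \<Longrightarrow> x 0 \<omega> = x0"
    and x_Suc: "\<And>k \<omega>. \<omega> \<in> space M \<Longrightarrow>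
      x (Suc k) \<omega> = (A + w k \<omega> *\<^sub>R Abar) *v x k \<omega> + (B + w k \<omega> *\<^sub>R Bbar) *v v k \<omega>"
begin

text \<open>\<open>v k\<close> is the input \<open>u (k - d)\<close> acting at time \<open>k\<close>. Under regular controls
  \<open>predicted k\<close> is \<open>E[x\<^sub>k | F\<^sub>k\<^sub>-\<^sub>d\<^sub>-\<^sub>1]\<close>, and \<open>innov k i\<close> is
  \<open>E[x\<^sub>k | F\<^sub>k\<^sub>-\<^sub>1\<^sub>-\<^sub>i] - E[x\<^sub>k | F\<^sub>k\<^sub>-\<^sub>2\<^sub>-\<^sub>i]\<close>; both are defined by recursion, which avoids
  conditional expectations until the feedback law is used.\<close>

definition gust :: "nat \<Rightarrow> 'a \<Rightarrow> real^'n" where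
  "gust k \<omega> = Abar *v x k \<omega> + Bbar *v v k \<omega>"

primrec innov :: "nat \<Rightarrow> nat \<Rightarrow> 'a \<Rightarrow> real^'n" where
  "innov 0 i \<omega> = 0"
| "innov (Suc k) i \<omega> = (case i of 0 \<Rightarrow> w k \<omega> *\<^sub>R gust k \<omega> | Suc i' \<Rightarrow> A *v innov k i' \<omega>)"

primrec predicted :: "nat \<Rightarrow> 'a \<Rightarrow> real^'n" where
  "predicted 0 \<omega> = x0"
| "predicted (Suc k) \<omega> = A *v predicted k \<omega> + A *v innov k (d - 1) \<omega> + B *v v k \<omega>"

text \<open>The index is the age of the innovation, with the prediction placed at \<open>d\<close>,
  to match the indices of the tuples \<open>P\<close>.\<close>

definition part :: "nat \<Rightarrow> nat \<Rightarrow> 'a \<Rightarrow> real^'n" where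
  "part k i = (if i < d then innov k i else predicted k)"

lemma innov_zero: "k \<le> i \<Longrightarrow> innov k i \<omega> = 0"
  by (induction k arbitrary: i) (auto split: nat.split)

lemma sum_part: "(\<Sum>i\<le>d. f i (part k i \<omega>)) = (\<Sum>i<d. f i (innov k i \<omega>)) + f d (predicted k \<omega>)"
  for f :: "nat \<Rightarrow> real^'n \<Rightarrow> 'b::comm_monoid_add"
  by (simp add: part_def flip: lessThan_Suc_atMost)

lemma sum_lessThan_d:
  fixes f :: "nat \<Rightarrow> 'b::comm_monoid_add"
  shows "(\<Sum>i<d. f i) = f 0 + (\<Sum>i<d - 1. f (Suc i))"
    and "(\<Sum>i<d. f i) = (\<Sum>i<d - 1. f i) + f (d - 1)"
proof -
  obtain e where "d = Suc e" using d_pos by (cases d) auto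
  then show "(\<Sum>i<d. f i) = f 0 + (\<Sum>i<d - 1. f (Suc i))"
    by (simp only: sum.lessThan_Suc_shift diff_Suc_1)
  from \<open>d = Suc e\<close> show "(\<Sum>i<d. f i) = (\<Sum>i<d - 1. f i) + f (d - 1)"
    by simp
qed

text \<open>At each step every innovation ages by one and the one of age d - 1 is absorbed by
  \<open>predicted\<close>. The identity is pathwise and independent of measurability.\<close>

lemma decomposition:
  assumes "\<omega> \<in> space M"
  shows "x k \<omega> = (\<Sum>i\<le>d. part k i \<omega>)"
proof -
  have "x k \<omega> = (\<Sum>i<d. innov k i \<omega>) + predicted k \<omega>"
  proof (induction k)
    case 0
    then show ?case by (simp add: x_0 assms)
  next
    case (Suc k)
    have "(\<Sum>i<d. innov (Suc k) i \<omega>) + predicted (Suc k) \<omega>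
        = w k \<omega> *\<^sub>R gust k \<omega> + (A *v (\<Sum>i<d - 1. innov k i \<omega>) + A *v innov k (d - 1) \<omega>
          + A *v predicted k \<omega>) + B *v v k \<omega>"
      unfolding sum_lessThan_d(1) by (simp add: linear_sum[OF matrix_vector_mul_linear])
    also have "\<dots> = w k \<omega> *\<^sub>R gust k \<omega> + A *v x k \<omega> + B *v v k \<omega>"
      unfolding Suc sum_lessThan_d(2) by (simp add: matrix_vector_right_distrib)
    also have "\<dots> = x (Suc k) \<omega>"
      using assms by (simp add: x_Suc gust_def matrix_vector_mult_add_rdistrib scaleR_add_right
          flip: scaleR_matrix_vector_assoc)
    finally show ?case by simp
  qed
  then show ?thesis using sum_part[of "\<lambda>_ y. y"] by simp
qed

text \<open>The second clause says that the innovation of age \<open>i\<close> has conditional mean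
  zero one step before it occurred, expressed by test vectors instead of a conditional
  expectation.\<close>

definition regular :: "nat \<Rightarrow> bool" where
  "regular k \<longleftrightarrow> (\<forall>i\<le>d. L2 M (past (int k - 1 - int i)) (part k i)) \<and>
     (\<forall>i<d. \<forall>h. L2 M (past (int k - 2 - int i)) h \<longrightarrow> expectation (\<lambda>\<omega>. part k i \<omega> \<bullet> h \<omega>) = 0)"

lemma regular_part_L2: "regular k \<Longrightarrow> i \<le> d \<Longrightarrow> L2 M (past (int k - 1 - int i)) (part k i)"
  by (simp add: regular_def)

lemma regular_part_L2M: "regular k \<Longrightarrow> i \<le> d \<Longrightarrow> L2 M M (part k i)"
  using regular_part_L2 L2_past by blast

lemma regular_x_L2:
  assumes "regular k"
  shows "L2 M (past (int k - 1)) (x k)"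
proof (rule L2_cong)
  show "L2 M (past (int k - 1)) (\<lambda>\<omega>. \<Sum>i\<le>d. part k i \<omega>)"
    by (intro L2_sum past_subalgebra L2_past_mono[OF _ regular_part_L2[OF assms]]) auto
qed (simp_all add: decomposition)

lemma regular_gust_L2:
  assumes "regular k" "L2 M (past (int k - int d - 1)) (v k)"
  shows "L2 M (past (int k - 1)) (gust k)"
  unfolding gust_def[abs_def]
  by (intro L2_add L2_matrix regular_x_L2 assms past_subalgebra L2_past_mono[OF _ assms(2)]) simp

text \<open>The part with the larger index is known before the other innovation occurs and is
  therefore a test vector for it; transposing \<open>C\<close> exchanges the two.\<close>

lemma regular_orthogonal:
  assumes "regular k" "i \<le> d" "j \<le> d" "i \<noteq> j"
  shows "expectation (\<lambda>\<omega>. part k i \<omega> \<bullet> (C *v part k j \<omega>)) = 0"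
proof -
  have *: "expectation (\<lambda>\<omega>. part k i \<omega> \<bullet> (C *v part k j \<omega>)) = 0" if "i < j" "j \<le> d" for i j C
  proof -
    have "L2 M (past (int k - 2 - int i)) (\<lambda>\<omega>. C *v part k j \<omega>)"
      using that by (intro L2_matrix past_subalgebra L2_past_mono[OF _ regular_part_L2[OF assms(1)]]) auto
    with that assms(1) show ?thesis by (auto simp: regular_def)
  qed
  show ?thesis
  proof (cases "i < j")
    case False
    with assms have "j < i" by simp
    have "part k i \<omega> \<bullet> (C *v part k j \<omega>) = part k j \<omega> \<bullet> (transpose C *v part k i \<omega>)" for \<omega>
      by (metis inner_commute inner_matrix_vector_left)
    with *[OF \<open>j < i\<close> assms(2), of "transpose C"] show ?thesis by simp
  qed (use * assms in auto)
qed

lemma regular_0: "regular 0"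
proof -
  have "innov 0 i = (\<lambda>_. 0)" "predicted 0 = (\<lambda>_. x0)" for i
    by auto
  then show ?thesis by (auto simp: regular_def part_def L2_const)
qed

text \<open>Ageing raises time and index together, so the relevant sigma-algebra is unchanged;
  independence handles the fresh innovation, and everything merged into index \<open>d\<close> is
  known at time k - d.\<close>

lemma regular_Suc:
  assumes reg: "regular k" and v: "L2 M (past (int k - int d - 1)) (v k)"
  shows "regular (Suc k)"
  unfolding regular_def
proof (intro conjI allI impI)
  note g = regular_gust_L2[OF reg v]
  fix i assume i: "i \<le> d"
  consider "i = 0" | i' where "i = Suc i'" "i < d" | "i = d"
    using i by (metis le_neq_implies_less not0_implies_Suc)
  then show "L2 M (past (int (Suc k) - 1 - int i)) (part (Suc k) i)"
  proof cases
    case 1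
    then have "part (Suc k) i = (\<lambda>\<omega>. w k \<omega> *\<^sub>R gust k \<omega>)"
      using d_pos by (auto simp: part_def)
    with L2_noise[OF g] 1 show ?thesis by simp
  next
    case 2
    then have "part (Suc k) i = (\<lambda>\<omega>. A *v part k i' \<omega>)"
      by (auto simp: part_def)
    with L2_matrix[OF regular_part_L2[OF reg, of i'] past_subalgebra] 2 show ?thesis
      by (simp add: algebra_simps)
  next
    case 3
    then have eq: "part (Suc k) i = (\<lambda>\<omega>. A *v part k d \<omega> + A *v part k (d - 1) \<omega> + B *v v k \<omega>)"
      using d_pos by (auto simp: part_def)
    show ?thesis
      unfolding eq using 3 d_pos
      by (intro L2_add L2_matrix past_subalgebra L2_past_mono[OF _ regular_part_L2[OF reg]]
          L2_past_mono[OF _ v]) auto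
  qed
next
  note g = regular_gust_L2[OF reg v]
  fix i and h :: "'a \<Rightarrow> real^'n" assume i: "i < d" and h: "L2 M (past (int (Suc k) - 2 - int i)) h"
  show "expectation (\<lambda>\<omega>. part (Suc k) i \<omega> \<bullet> h \<omega>) = 0"
  proof (cases i)
    case 0
    with i noise_orthogonal[OF g] h show ?thesis by (simp add: part_def)
  next
    case (Suc i')
    have "L2 M (past (int k - 2 - int i')) (\<lambda>\<omega>. transpose A *v h \<omega>)"
      using h Suc by (intro L2_matrix past_subalgebra) (simp add: algebra_simps)
    with reg Suc i have "expectation (\<lambda>\<omega>. part k i' \<omega> \<bullet> (transpose A *v h \<omega>)) = 0"
      unfolding regular_def by auto
    with Suc i show ?thesis by (simp add: part_def inner_matrix_vector_left del: transpose_matrix_vector)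
  qed
qed

lemma regularI: "(\<And>j. j < k \<Longrightarrow> L2 M (past (int j - int d - 1)) (v j)) \<Longrightarrow> regular k"
  by (induction k) (auto simp: regular_0 regular_Suc)

text \<open>The trace pairing of the tuple \<open>P\<close> with the second-moment matrices of the
  parts.\<close>

definition energy :: "nat \<Rightarrow> (nat \<Rightarrow> real^'n^'n) \<Rightarrow> real" where
  "energy k P = (\<Sum>i\<le>d. expectation (\<lambda>\<omega>. qf (P i) (part k i \<omega>)))"

lemma energy_0: "energy 0 P = qf (P d) x0"
  unfolding energy_def lessThan_Suc_atMost[symmetric] by (simp add: part_def prob_space)

lemma energy_const:
  assumes "regular k"
  shows "expectation (\<lambda>\<omega>. qf Y (x k \<omega>)) = energy k (\<lambda>_. Y)"
proof -
  have "expectation (\<lambda>\<omega>. qf Y (x k \<omega>)) = expectation (\<lambda>\<omega>. qf Y (\<Sum>i\<le>d. part k i \<omega>))"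
    by (intro Bochner_Integration.integral_cong) (simp_all add: decomposition)
  also have "\<dots> = energy k (\<lambda>_. Y)"
    unfolding energy_def using assms
    by (intro expectation_qf_sum regular_part_L2M regular_orthogonal) auto
  finally show ?thesis .
qed

text \<open>Adjointness of \<open>lyap K\<close> to the closed-loop evolution. The fresh innovation
  is fed by all parts through \<open>diffusion\<close> and weighed by \<open>P 0\<close>; the other
  parts age, and those at d - 1 and \<open>d\<close> merge, whence \<open>min (Suc i) d\<close>.
  Orthogonality removes the cross terms.\<close>

lemma energy_Suc:
  assumes reg: "regular k" and v: "L2 M (past (int k - int d - 1)) (v k)"
    and fb: "AE \<omega> in M. v k \<omega> = - (K *v predicted k \<omega>)"
  shows "energy (Suc k) P = energy k (lyap K P)"
proof -
  let ?E = "\<lambda>i. expectation (\<lambda>\<omega>. qf (P (min (Suc i) d)) (drift K i *v part k i \<omega>))"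
  note g = regular_gust_L2[OF reg v]
  have subM: "subalgebra M M" by (simp add: subalgebra_def)
  have orth: "expectation (\<lambda>\<omega>. (C *v part k i \<omega>) \<bullet> (D *v (C' *v part k j \<omega>))) = 0"
    if "i \<le> d" "j \<le> d" "i \<noteq> j" for C D C' i j
    using regular_orthogonal[OF reg that, of "transpose C ** D ** C'"]
    by (simp add: inner_matrix_vector_left matrix_vector_mul_assoc matrix_mul_assoc del: transpose_matrix_vector)
  have meas: "part (Suc k) i \<in> borel_measurable M" if "i \<le> d" for i
    using regular_part_L2M[OF regular_Suc[OF reg v] that] by (simp add: L2_def)
  have qf_meas: "qf Y \<in> borel_measurable borel" for Y :: "real^'n^'n"
    unfolding qf_def by measurable
  have first: "expectation (\<lambda>\<omega>. qf (P 0) (part (Suc k) 0 \<omega>))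
      = (\<Sum>i\<le>d. expectation (\<lambda>\<omega>. qf (P 0) (diffusion K i *v part k i \<omega>)))"
  proof -
    have "expectation (\<lambda>\<omega>. qf (P 0) (part (Suc k) 0 \<omega>)) = expectation (\<lambda>\<omega>. qf (P 0) (w k \<omega> *\<^sub>R gust k \<omega>))"
      using d_pos by (simp add: part_def)
    also have "\<dots> = expectation (\<lambda>\<omega>. qf (P 0) (gust k \<omega>))"
      by (rule noise_qf[OF g])
    also have "\<dots> = expectation (\<lambda>\<omega>. qf (P 0) (\<Sum>i\<le>d. diffusion K i *v part k i \<omega>))"
    proof (rule integral_cong_AE)
      have "L2 M M (gust k)" "L2 M M (\<lambda>\<omega>. \<Sum>i\<le>d. diffusion K i *v part k i \<omega>)"
        using g L2_past by (auto intro!: L2_sum L2_matrix subM regular_part_L2M[OF reg])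
      then show "(\<lambda>\<omega>. qf (P 0) (gust k \<omega>)) \<in> borel_measurable M"
        "(\<lambda>\<omega>. qf (P 0) (\<Sum>i\<le>d. diffusion K i *v part k i \<omega>)) \<in> borel_measurable M"
        using qf_meas unfolding L2_def by (auto intro: measurable_compose)
      show "AE \<omega> in M. qf (P 0) (gust k \<omega>) = qf (P 0) (\<Sum>i\<le>d. diffusion K i *v part k i \<omega>)"
        using fb AE_space
      proof eventually_elim
        case (elim \<omega>)
        have "(\<Sum>i\<le>d. diffusion K i *v part k i \<omega>) = gust k \<omega>"
          unfolding gust_def decomposition[OF elim(2)] sum_part[of "\<lambda>i y. diffusion K i *v y"]
            sum_part[of "\<lambda>i y. y"] elim(1)
          by (simp add: diffusion_def matrix_vector_right_distrib linear_sum[OF matrix_vector_mul_linear]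
              matrix_vector_mult_diff_rdistrib matrix_vector_mul_assoc linear_neg[OF matrix_vector_mul_linear])
        then show ?case by simp
      qed
    qed
    also have "\<dots> = (\<Sum>i\<le>d. expectation (\<lambda>\<omega>. qf (P 0) (diffusion K i *v part k i \<omega>)))"
      by (intro expectation_qf_sum L2_matrix subM regular_part_L2M[OF reg] orth) auto
    finally show ?thesis .
  qed
  have last: "expectation (\<lambda>\<omega>. qf (P d) (part (Suc k) d \<omega>)) = ?E d + ?E (d - 1)"
  proof -
    have "expectation (\<lambda>\<omega>. qf (P d) (part (Suc k) d \<omega>))
        = expectation (\<lambda>\<omega>. qf (P d) (drift K d *v part k d \<omega> + drift K (d - 1) *v part k (d - 1) \<omega>))"
    proof (rule integral_cong_AE)
      have "L2 M M (\<lambda>\<omega>. drift K d *v part k d \<omega> + drift K (d - 1) *v part k (d - 1) \<omega>)"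
        by (intro L2_add L2_matrix subM regular_part_L2M[OF reg]) auto
      then show "(\<lambda>\<omega>. qf (P d) (part (Suc k) d \<omega>)) \<in> borel_measurable M"
        "(\<lambda>\<omega>. qf (P d) (drift K d *v part k d \<omega> + drift K (d - 1) *v part k (d - 1) \<omega>)) \<in> borel_measurable M"
        using qf_meas meas[of d] unfolding L2_def by (auto intro: measurable_compose)
      show "AE \<omega> in M. qf (P d) (part (Suc k) d \<omega>)
          = qf (P d) (drift K d *v part k d \<omega> + drift K (d - 1) *v part k (d - 1) \<omega>)"
        using fb
      proof eventually_elim
        case (elim \<omega>)
        have "part (Suc k) d \<omega> = drift K d *v part k d \<omega> + drift K (d - 1) *v part k (d - 1) \<omega>"
          using d_pos by (simp add: part_def drift_def elim matrix_vector_mult_diff_rdistrib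
              matrix_vector_mul_assoc linear_neg[OF matrix_vector_mul_linear])
        then show ?case by simp
      qed
    qed
    also have "\<dots> = expectation (\<lambda>\<omega>. qf (P d) (drift K d *v part k d \<omega>))
        + expectation (\<lambda>\<omega>. qf (P d) (drift K (d - 1) *v part k (d - 1) \<omega>))"
      using d_pos by (intro expectation_qf_add L2_matrix subM regular_part_L2M[OF reg] orth) auto
    finally show ?thesis using d_pos by simp
  qed
  have mid: "expectation (\<lambda>\<omega>. qf (P (Suc i)) (part (Suc k) (Suc i) \<omega>)) = ?E i" if "i < d - 1" for i
  proof -
    have "Suc i < d" "i < d" using that by auto
    then show ?thesis by (simp add: part_def drift_def)
  qed
  have "energy (Suc k) P = expectation (\<lambda>\<omega>. qf (P 0) (part (Suc k) 0 \<omega>))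
      + (\<Sum>i<d - 1. expectation (\<lambda>\<omega>. qf (P (Suc i)) (part (Suc k) (Suc i) \<omega>)))
      + expectation (\<lambda>\<omega>. qf (P d) (part (Suc k) d \<omega>))"
    unfolding energy_def lessThan_Suc_atMost[symmetric] sum.lessThan_Suc sum_lessThan_d(1) ..
  also have "\<dots> = (\<Sum>i\<le>d. expectation (\<lambda>\<omega>. qf (P 0) (diffusion K i *v part k i \<omega>)))
      + ((\<Sum>i<d - 1. ?E i) + ?E (d - 1) + ?E d)"
    unfolding first last using mid by simp
  also have "(\<Sum>i<d - 1. ?E i) + ?E (d - 1) + ?E d = (\<Sum>i\<le>d. ?E i)"
    unfolding lessThan_Suc_atMost[symmetric] sum.lessThan_Suc sum_lessThan_d(2) ..
  also have "(\<Sum>i\<le>d. expectation (\<lambda>\<omega>. qf (P 0) (diffusion K i *v part k i \<omega>))) + (\<Sum>i\<le>d. ?E i)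
      = energy k (lyap K P)"
    unfolding energy_def qf_lyap sum.distrib[symmetric]
  proof (intro sum.cong refl)
    fix i assume "i \<in> {..d}"
    then have "integrable M (\<lambda>\<omega>. qf Y (C *v part k i \<omega>))" for Y C
      by (intro L2_qf_integrable L2_matrix subM regular_part_L2M[OF reg]) auto
    then show "expectation (\<lambda>\<omega>. qf (P 0) (diffusion K i *v part k i \<omega>)) + ?E i
        = expectation (\<lambda>\<omega>. qf (P (min (Suc i) d)) (drift K i *v part k i \<omega>)
            + qf (P 0) (diffusion K i *v part k i \<omega>))"
      by (subst Bochner_Integration.integral_add) (simp_all add: add.commute)
  qed
  finally show ?thesis .
qed

lemma energy_iterate:
  assumes "\<And>j. regular j" "\<And>j. L2 M (past (int j - int d - 1)) (v j)"
    and "\<And>j. k \<le> j \<Longrightarrow> AE \<omega> in M. v j \<omega> = - (K *v predicted j \<omega>)"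
  shows "energy (k + n) P = energy k ((lyap K ^^ n) P)"
proof (induction n arbitrary: P)
  case (Suc n)
  have "energy (k + Suc n) P = energy (k + n) (lyap K P)"
    using energy_Suc[OF assms(1,2) assms(3)[of "k + n"]] by simp
  with Suc show ?case by (simp add: funpow_swap1)
qed simp

text \<open>Up to time \<open>d\<close> an uncontrolled deterministic start evolves like an innovation that
  occurred at time \<open>0\<close>: the predicted part takes over the role of index \<open>k\<close> at time \<open>k\<close>, hence the
  update of \<open>P\<close> at \<open>d\<close> in the induction.\<close>

lemma energy_uncontrolled:
  assumes "\<And>j. regular j" "\<And>j. L2 M (past (int j - int d - 1)) (v j)"
    and "\<And>j \<omega>. j < d \<Longrightarrow> \<omega> \<in> space M \<Longrightarrow> v j \<omega> = 0"
  shows "energy d P = qf ((lyap K ^^ d) P 0) x0"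
proof -
  have "energy k (P(d := P k)) = qf ((lyap K ^^ k) P 0) x0" if "k \<le> d" for k
    using that
  proof (induction k arbitrary: P)
    case (Suc k)
    \<comment> \<open>Zero input is feedback with gain 0, which acts like \<open>K\<close> below
      index \<open>d\<close>; parts with \<open>k \<le> i < d\<close> still vanish, so the tuples
      may differ there.\<close>
    have "energy (Suc k) (P(d := P (Suc k))) = energy k (lyap 0 (P(d := P (Suc k))))"
      using Suc.prems by (intro energy_Suc assms(1,2) AE_I2) (simp add: assms(3))
    also have "\<dots> = energy k ((lyap K P)(d := lyap K P k))"
      unfolding energy_def
    proof (intro sum.cong refl)
      fix i assume "i \<in> {..d}"
      consider "i < k" | "k \<le> i" "i < d" | "i = d" using \<open>i \<in> {..d}\<close> by fastforce
      then show "expectation (\<lambda>\<omega>. qf (lyap 0 (P(d := P (Suc k))) i) (part k i \<omega>))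
          = expectation (\<lambda>\<omega>. qf (((lyap K P)(d := lyap K P k)) i) (part k i \<omega>))"
      proof cases
        case 1
        with Suc.prems d_pos have "lyap 0 (P(d := P (Suc k))) i = ((lyap K P)(d := lyap K P k)) i"
          by (simp add: lyap_def drift_def diffusion_def)
        then show ?thesis by simp
      next
        case 2
        then show ?thesis by (simp add: part_def innov_zero)
      next
        case 3
        with Suc.prems d_pos have "lyap 0 (P(d := P (Suc k))) i = ((lyap K P)(d := lyap K P k)) i"
          by (simp add: lyap_def drift_def diffusion_def min_def)
        then show ?thesis by simp
      qed
    qed
    also have "\<dots> = qf ((lyap K ^^ k) (lyap K P) 0) x0"
      by (rule Suc.IH) (use Suc.prems in simp)
    finally show ?case by (simp only: funpow_Suc_right comp_apply)
  qed (simp add: energy_0)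
  from this[of d] show ?thesis by simp
qed

text \<open>\<open>predicted k\<close> is measurable at time k - d - 1, and the rest of
  \<open>x k\<close> is a sum of innovations orthogonal to every indicator of an event of that time;
  this characterises the conditional expectation.\<close>

lemma predictor_eq:
  assumes reg: "regular k" and "d \<le> k"
  shows "AE \<omega> in M. vec_cond_exp M (past (int k - int d - 1)) (x k) \<omega> = predicted k \<omega>"
proof -
  let ?F = "past (int k - int d - 1)"
  interpret sigma_finite_subalgebra M ?F by (rule past_sigma_finite)
  have predicted: "L2 M ?F (predicted k)"
    using regular_part_L2[OF reg, of d] by (simp add: part_def algebra_simps)
  have "AE \<omega> in M. real_cond_exp M ?F (\<lambda>\<omega>. x k \<omega> $ a) \<omega> = predicted k \<omega> $ a" for a
  proof (rule real_cond_exp_charact)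
    have ax: "L2 M G (\<lambda>_. axis a 1 :: real^'n)" for G by (rule L2_const)
    have "L2 M M (x k)" "L2 M M (predicted k)"
      using regular_x_L2[OF reg] predicted L2_past by blast+
    from this[THEN L2_inner_integrable, OF ax]
    show "integrable M (\<lambda>\<omega>. x k \<omega> $ a)" "integrable M (\<lambda>\<omega>. predicted k \<omega> $ a)"
      by (simp_all add: inner_axis)
    show "(\<lambda>\<omega>. predicted k \<omega> $ a) \<in> borel_measurable ?F"
      using L2_past_inner(1)[OF predicted ax] by (simp add: inner_axis)
    fix S assume S: "S \<in> sets ?F"
    let ?h = "\<lambda>\<omega>. indicator S \<omega> *\<^sub>R axis a 1 :: real^'n"
    have h: "L2 M ?F ?h"
    proof (rule L2_dominated[OF _ L2_const[of _ 1] past_subalgebra])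
      show "?h \<in> borel_measurable ?F" using S by simp
      show "norm (?h \<omega>) \<le> 1 * norm (1::real)" for \<omega> by (simp add: indicator_def)
    qed
    have set: "(LINT \<omega>:S|M. f \<omega> $ a) = expectation (\<lambda>\<omega>. f \<omega> \<bullet> ?h \<omega>)" for f :: "'a \<Rightarrow> real^'n"
      by (simp add: set_lebesgue_integral_def inner_axis)
    have "expectation (\<lambda>\<omega>. x k \<omega> \<bullet> ?h \<omega>) = expectation (\<lambda>\<omega>. \<Sum>i\<le>d. part k i \<omega> \<bullet> ?h \<omega>)"
      by (rule Bochner_Integration.integral_cong[OF refl]) (simp only: decomposition inner_sum_left)
    also have "\<dots> = (\<Sum>i\<le>d. expectation (\<lambda>\<omega>. part k i \<omega> \<bullet> ?h \<omega>))"
      by (intro Bochner_Integration.integral_sum L2_inner_integrable regular_part_L2M[OF reg] L2_past[OF h]) simp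
    also have "\<dots> = (\<Sum>i<d. expectation (\<lambda>\<omega>. part k i \<omega> \<bullet> ?h \<omega>)) + expectation (\<lambda>\<omega>. predicted k \<omega> \<bullet> ?h \<omega>)"
      unfolding lessThan_Suc_atMost[symmetric] by (simp add: part_def)
    also have "(\<Sum>i<d. expectation (\<lambda>\<omega>. part k i \<omega> \<bullet> ?h \<omega>)) = 0"
    proof (rule sum.neutral, rule ballI)
      fix i assume "i \<in> {..<d}"
      \<comment> \<open>From \<open>i < d\<close> follows k - d - 1 <= k - 2 - i, so the indicator
        is an admissible test vector.\<close>
      then have "L2 M (past (int k - 2 - int i)) ?h" "i < d"
        by (auto intro: L2_past_mono[OF _ h])
      then show "expectation (\<lambda>\<omega>. part k i \<omega> \<bullet> ?h \<omega>) = 0"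
        using reg unfolding regular_def by blast
    qed
    finally show "(LINT \<omega>:S|M. x k \<omega> $ a) = (LINT \<omega>:S|M. predicted k \<omega> $ a)"
      unfolding set by simp
  qed
  then have "AE \<omega> in M. \<forall>a. real_cond_exp M ?F (\<lambda>\<omega>. x k \<omega> $ a) \<omega> = predicted k \<omega> $ a"
    by (simp add: AE_all_countable)
  then show ?thesis
    by eventually_elim (simp add: vec_cond_exp_def vec_eq_iff)
qed

text \<open>The past sigma-algebras are not completed, so an almost-everywhere identity does not
  carry measurability over: this comes from the conditional expectation itself, integrability from
  \<open>predicted\<close>.\<close>

lemma feedback_L2:
  assumes reg: "regular k" and "d \<le> k"
    and v: "\<And>\<omega>. \<omega> \<in> space M \<Longrightarrow> v k \<omega> = - (K *v vec_cond_exp M (past (int k - int d - 1)) (x k) \<omega>)"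
  shows "AE \<omega> in M. v k \<omega> = - (K *v predicted k \<omega>)" "L2 M (past (int k - int d - 1)) (v k)"
proof -
  let ?F = "past (int k - int d - 1)"
  let ?c = "vec_cond_exp M ?F (x k)"
  show "AE \<omega> in M. v k \<omega> = - (K *v predicted k \<omega>)"
    using predictor_eq[OF assms(1,2)] AE_space by eventually_elim (simp add: v)
  have predicted: "L2 M ?F (predicted k)"
    using regular_part_L2[OF reg, of d] by (simp add: part_def algebra_simps)
  have meas: "?c \<in> borel_measurable ?F"
  proof (rule borel_measurable_euclidean_space[THEN iffD2], rule ballI)
    fix b :: "real^'n" assume "b \<in> Basis"
    then obtain a where "b = axis a 1" by (auto simp: Basis_vec_def)
    then have "(\<lambda>\<omega>. ?c \<omega> \<bullet> b) = real_cond_exp M ?F (\<lambda>\<omega>. x k \<omega> $ a)"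
      by (simp add: inner_axis vec_cond_exp_def fun_eq_iff)
    then show "(\<lambda>\<omega>. ?c \<omega> \<bullet> b) \<in> borel_measurable ?F"
      by (simp only: borel_measurable_cond_exp)
  qed
  have [measurable]: "?c \<in> borel_measurable M" "predicted k \<in> borel_measurable M"
    using meas predicted measurable_from_subalg past_subalgebra unfolding L2_def by blast+
  have "AE \<omega> in M. (norm (predicted k \<omega>))\<^sup>2 = (norm (?c \<omega>))\<^sup>2"
    using predictor_eq[OF assms(1,2)] by eventually_elim simp
  moreover have "integrable M (\<lambda>\<omega>. (norm (predicted k \<omega>))\<^sup>2)"
    using predicted by (simp add: L2_def)
  ultimately have "integrable M (\<lambda>\<omega>. (norm (?c \<omega>))\<^sup>2)"
    by (subst integrable_cong_AE[symmetric]) auto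
  with meas have "L2 M ?F ?c" by (simp add: L2_def)
  then have "L2 M ?F (\<lambda>\<omega>. (- K) *v ?c \<omega>)"
    by (intro L2_matrix past_subalgebra)
  then show "L2 M ?F (v k)"
    by (rule L2_cong[rotated 2]) (simp_all add: v matrix_vector_mult_minus_left)
qed

end

section \<open>Stabilizing gains\<close>

context delay_lqr
begin

text \<open>For \<open>i < d\<close>, power k+1 at \<open>i\<close> is determined by power k at
  \<open>Suc i\<close> and at 0, so decay descends from \<open>d\<close> once index 0 is
  known.\<close>

lemma stableI:
  assumes "\<And>x. (\<lambda>k. qf ((lyap K ^^ k) (\<lambda>_. mat 1) d) x) \<longlonglongrightarrow> 0"
    and "\<And>x. (\<lambda>k. qf ((lyap K ^^ k) (\<lambda>_. mat 1) 0) x) \<longlonglongrightarrow> 0"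
  shows "stable K"
  unfolding stable_def
proof (intro allI impI)
  fix i x assume "i \<le> d"
  then show "(\<lambda>k. qf ((lyap K ^^ k) (\<lambda>_. mat 1) i) x) \<longlonglongrightarrow> 0"
  proof (induction i arbitrary: x rule: inc_induct)
    case base
    show ?case by (rule assms(1))
  next
    case (step i)
    have "(\<lambda>k. qf ((lyap K ^^ k) (\<lambda>_. mat 1) (Suc i)) (A *v x)
        + qf ((lyap K ^^ k) (\<lambda>_. mat 1) 0) (Abar *v x)) \<longlonglongrightarrow> 0 + 0"
      by (intro tendsto_add step.IH assms(2))
    then have "(\<lambda>k. qf ((lyap K ^^ Suc k) (\<lambda>_. mat 1) i) x) \<longlonglongrightarrow> 0"
      using step.hyps by (simp add: qf_lyap drift_def diffusion_def min_def)
    then show ?case by (rule LIMSEQ_imp_Suc)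
  qed
qed

end

lemma (in white_noise_space) expectation_qf_tendsto_zero:
  fixes S :: "nat \<Rightarrow> real^'n^'n"
  assumes "S \<longlonglongrightarrow> 0" "L2 M M f"
  shows "(\<lambda>n. expectation (\<lambda>\<omega>. qf (S n) (f \<omega>))) \<longlonglongrightarrow> 0"
proof -
  obtain c where c: "c \<ge> 0" "\<And>P x. \<bar>qf P x\<bar> \<le> c * norm (P::real^'n^'n) * (norm x)\<^sup>2"
    using qf_le_norm by blast
  have int: "integrable M (\<lambda>\<omega>. (norm (f \<omega>))\<^sup>2)" using assms(2) by (simp add: L2_def)
  have bound: "\<bar>expectation (\<lambda>\<omega>. qf (S n) (f \<omega>))\<bar> \<le> c * norm (S n) * expectation (\<lambda>\<omega>. (norm (f \<omega>))\<^sup>2)" for n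
  proof -
    have "\<bar>expectation (\<lambda>\<omega>. qf (S n) (f \<omega>))\<bar> \<le> expectation (\<lambda>\<omega>. \<bar>qf (S n) (f \<omega>)\<bar>)"
      by (rule integral_abs_bound)
    also have "\<dots> \<le> expectation (\<lambda>\<omega>. c * norm (S n) * (norm (f \<omega>))\<^sup>2)"
      by (intro integral_mono integrable_abs L2_qf_integrable assms(2) integrable_mult_right int c(2))
    finally show ?thesis by simp
  qed
  have "(\<lambda>n. c * norm (S n) * expectation (\<lambda>\<omega>. (norm (f \<omega>))\<^sup>2))
      \<longlonglongrightarrow> c * norm (0::real^'n^'n) * expectation (\<lambda>\<omega>. (norm (f \<omega>))\<^sup>2)"
    by (intro tendsto_intros assms(1))
  then have lim: "(\<lambda>n. c * norm (S n) * expectation (\<lambda>\<omega>. (norm (f \<omega>))\<^sup>2)) \<longlonglongrightarrow> 0"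
    by simp
  show ?thesis
    by (rule Lim_null_comparison[OF always_eventually lim]) (simp add: bound)
qed

text \<open>Inputs are indexed by the time at which they act: \<open>v k\<close> is u_(k-d), and the
  initial inputs are those with \<open>k < d\<close>.\<close>

locale delayed_feedback = trajectory M w d A Abar B Bbar Q R x v x0
  for M :: "'a measure" and w and d and A Abar :: "real^'n^'n" and B Bbar :: "real^'m^'n" and Q R
    and x :: "nat \<Rightarrow> 'a \<Rightarrow> real^'n" and v :: "nat \<Rightarrow> 'a \<Rightarrow> real^'m" and x0 +
  fixes K :: "real^'n^'m" and u0 :: "nat \<Rightarrow> real^'m"
  assumes open_loop: "\<And>k \<omega>. k < d \<Longrightarrow> \<omega> \<in> space M \<Longrightarrow> v k \<omega> = u0 k"
    and feedback: "\<And>k \<omega>. d \<le> k \<Longrightarrow> \<omega> \<in> space M \<Longrightarrow>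
      v k \<omega> = - (K *v vec_cond_exp M (past (int k - int d - 1)) (x k) \<omega>)"
begin

text \<open>Regularity at \<open>k\<close> requires only the controls before \<open>k\<close>, and
  it makes the control at \<open>k\<close> square integrable; strong induction resolves this mutual
  dependence.\<close>

lemma control_L2: "L2 M (past (int k - int d - 1)) (v k)"
proof (induction k rule: less_induct)
  case (less k)
  show ?case
  proof (cases "k < d")
    case True
    show ?thesis
      by (rule L2_cong[OF _ _ L2_const[of _ "u0 k"]]) (simp_all add: open_loop True)
  next
    case False
    then show ?thesis
      using feedback_L2(2)[OF regularI[OF less.IH], of k] feedback[of k] by simp
  qed
qed

lemma all_regular: "regular k"
  by (rule regularI) (rule control_L2)

lemma closed_loop: "d \<le> k \<Longrightarrow> AE \<omega> in M. v k \<omega> = - (K *v predicted k \<omega>)"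
  by (rule feedback_L2(1)[OF all_regular]) (use feedback in auto)

lemma mean_square: "expectation (\<lambda>\<omega>. x k \<omega> \<bullet> x k \<omega>) = energy k (\<lambda>_. mat 1)"
  using energy_const[OF all_regular, of "mat 1" k] by (simp add: qf_mat1 power2_norm_eq_inner)

lemma mean_square_iterate:
  "expectation (\<lambda>\<omega>. x (d + n) \<omega> \<bullet> x (d + n) \<omega>) = energy d ((lyap K ^^ n) (\<lambda>_. mat 1))"
  unfolding mean_square by (rule energy_iterate[OF all_regular control_L2 closed_loop])

lemma stable_imp_mean_square_stable:
  assumes "stable K"
  shows "(\<lambda>k. expectation (\<lambda>\<omega>. x k \<omega> \<bullet> x k \<omega>)) \<longlonglongrightarrow> 0"
proof (rule LIMSEQ_offset)
  have "(\<lambda>n. energy d ((lyap K ^^ n) (\<lambda>_. mat 1))) \<longlonglongrightarrow> (\<Sum>i\<le>d. 0)"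
    unfolding energy_def
    by (intro tendsto_sum expectation_qf_tendsto_zero stable_tendsto_zero assms
        regular_part_L2M[OF all_regular]) auto
  then show "(\<lambda>n. expectation (\<lambda>\<omega>. x (n + d) \<omega> \<bullet> x (n + d) \<omega>)) \<longlonglongrightarrow> 0"
    by (simp add: mean_square_iterate add.commute[of _ d])
qed

lemma predicted_open_loop:
  assumes "\<And>k. k < d \<Longrightarrow> u0 k = - (K *v y k)" "y 0 = x0" "\<And>k. y (Suc k) = (A - B ** K) *v y k"
    and "k \<le> d" "\<omega> \<in> space M"
  shows "predicted k \<omega> = y k"
  using assms(4)
proof (induction k)
  case (Suc k)
  then have "innov k (d - 1) \<omega> = 0" by (intro innov_zero) auto
  with Suc assms show ?case
    by (simp add: open_loop matrix_vector_mult_diff_rdistrib matrix_vector_mul_assoc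
        linear_neg[OF matrix_vector_mul_linear])
qed (simp add: assms)

text \<open>With these initial inputs the feedback law holds from time 0 on, since no innovation
  reaches \<open>predicted\<close> up to time \<open>d\<close>. The energy can then be iterated from
  time 0, where only index \<open>d\<close> contributes.\<close>

lemma mean_square_predicted_start:
  assumes "\<And>k. k < d \<Longrightarrow> u0 k = - (K *v y k)" "y 0 = x0" "\<And>k. y (Suc k) = (A - B ** K) *v y k"
  shows "expectation (\<lambda>\<omega>. x k \<omega> \<bullet> x k \<omega>) = qf ((lyap K ^^ k) (\<lambda>_. mat 1) d) x0"
proof -
  have "AE \<omega> in M. v j \<omega> = - (K *v predicted j \<omega>)" for j
  proof (cases "j < d")
    case True
    show ?thesis
      using AE_space
    proof eventually_elim
      case (elim \<omega>)
      have "predicted j \<omega> = y j" using True by (intro predicted_open_loop assms elim) auto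
      with True show ?case by (simp add: open_loop elim assms(1))
    qed
  qed (simp add: closed_loop)
  then have "energy (0 + k) (\<lambda>_. mat 1) = energy 0 ((lyap K ^^ k) (\<lambda>_. mat 1))"
    by (intro energy_iterate all_regular control_L2)
  then show ?thesis by (simp add: mean_square energy_0)
qed

end

section \<open>Existence of closed-loop trajectories and transfer to the probabilistic
  notions\<close>

context delay_lqr
begin

text \<open>The control law receives the whole random vector rather than its value at a point,
  because conditional expectation is not pointwise.\<close>

primrec state :: "'a measure \<Rightarrow> (nat \<Rightarrow> 'a \<Rightarrow> real) \<Rightarrow> (nat \<Rightarrow> ('a \<Rightarrow> real^'n) \<Rightarrow> 'a \<Rightarrow> real^'m)
    \<Rightarrow> real^'n \<Rightarrow> nat \<Rightarrow> 'a \<Rightarrow> real^'n" where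
  "state M w U x0 0 = (\<lambda>\<omega>. x0)"
| "state M w U x0 (Suc k) = (\<lambda>\<omega>. (A + w k \<omega> *\<^sub>R Abar) *v state M w U x0 k \<omega>
     + (B + w k \<omega> *\<^sub>R Bbar) *v U k (state M w U x0 k) \<omega>)"

definition control :: "'a measure \<Rightarrow> (nat \<Rightarrow> 'a \<Rightarrow> real) \<Rightarrow> real^'n^'m \<Rightarrow> (nat \<Rightarrow> real^'m)
    \<Rightarrow> nat \<Rightarrow> ('a \<Rightarrow> real^'n) \<Rightarrow> 'a \<Rightarrow> real^'m" where
  "control M w K u0 k f \<omega> = (if k < d then u0 k
     else - (K *v vec_cond_exp M (noise_filtration M w (int k - int d - 1)) f \<omega>))"

text \<open>\<open>stabilizing\<close> quantifies over all trajectories, so drawing stability from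
  it requires an actual closed-loop trajectory for the chosen data.\<close>

lemma closed_loop_exists:
  fixes M :: "'a measure"
  assumes "white_noise M w" "1 \<le> d"
  shows "\<exists>x u. delay_trajectory M w d A Abar B Bbar x0 (\<lambda>i. u0 (nat (i + int d))) x u \<and>
    predictor_feedback M w d K x u \<and>
    delayed_feedback M w d A Abar B Bbar Q R x (\<lambda>k. u (int k - int d)) x0 K u0"
proof -
  let ?U = "control M w K u0"
  let ?x = "state M w ?U x0"
  define u where "u i = ?U (nat (i + int d)) (?x (nat (i + int d)))" for i
  have u: "u (int k - int d) = ?U k (?x k)" for k by (simp add: u_def)
  have "delay_trajectory M w d A Abar B Bbar x0 (\<lambda>i. u0 (nat (i + int d))) ?x u"
    unfolding delay_trajectory_def u by (auto simp: u_def control_def)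
  moreover have "predictor_feedback M w d K ?x u"
    unfolding predictor_feedback_def u by (auto simp: control_def)
  moreover have "delayed_feedback M w d A Abar B Bbar Q R ?x (\<lambda>k. u (int k - int d)) x0 K u0"
  proof -
    interpret prob_space M using assms(1) by (simp add: white_noise_def)
    show ?thesis
      by unfold_locales (use assms in \<open>auto simp: u control_def\<close>)
  qed
  ultimately show ?thesis by blast
qed

text \<open>The initial inputs \<open>- K (A - B K)\<^sup>k x0\<close> isolate the component \<open>d\<close> of the powers of \<open>lyap K\<close>,
  and zero initial inputs isolate the component \<open>0\<close>; the other components follow from these two.\<close>

theorem stabilizing_iff_stable:
  fixes M :: "'a measure"
  assumes wn: "white_noise M w" and d: "1 \<le> d"
  shows "stabilizing M w d A Abar B Bbar K \<longleftrightarrow> stable K"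
proof
  assume K: "stabilizing M w d A Abar B Bbar K"
  show "stable K"
  proof (rule stableI)
    fix x0
    define y where "y k = (((*v) (A - B ** K)) ^^ k) x0" for k
    define u0 where "u0 k = - (K *v y k)" for k
    obtain x u where T: "delay_trajectory M w d A Abar B Bbar x0 (\<lambda>i. u0 (nat (i + int d))) x u"
      "predictor_feedback M w d K x u"
      "delayed_feedback M w d A Abar B Bbar Q R x (\<lambda>k. u (int k - int d)) x0 K u0"
      using closed_loop_exists[OF assms] by blast
    interpret delayed_feedback M w d A Abar B Bbar Q R x "\<lambda>k. u (int k - int d)" x0 K u0
      by (rule T)
    have "(\<lambda>k. expectation (\<lambda>\<omega>. x k \<omega> \<bullet> x k \<omega>)) \<longlonglongrightarrow> 0"
      using K T unfolding stabilizing_def by blast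
    also have "(\<lambda>k. expectation (\<lambda>\<omega>. x k \<omega> \<bullet> x k \<omega>)) = (\<lambda>k. qf ((lyap K ^^ k) (\<lambda>_. mat 1) d) x0)"
      by (intro ext mean_square_predicted_start[of y]) (simp_all add: u0_def y_def)
    finally show "(\<lambda>k. qf ((lyap K ^^ k) (\<lambda>_. mat 1) d) x0) \<longlonglongrightarrow> 0" .
  next
    fix x0
    let ?u0 = "\<lambda>_::nat. 0 :: real^'m"
    obtain x u where T: "delay_trajectory M w d A Abar B Bbar x0 (\<lambda>i. ?u0 (nat (i + int d))) x u"
      "predictor_feedback M w d K x u"
      "delayed_feedback M w d A Abar B Bbar Q R x (\<lambda>k. u (int k - int d)) x0 K ?u0"
      using closed_loop_exists[OF assms, of x0 ?u0] by blast
    interpret delayed_feedback M w d A Abar B Bbar Q R x "\<lambda>k. u (int k - int d)" x0 K ?u0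
      by (rule T)
    have "(\<lambda>k. expectation (\<lambda>\<omega>. x k \<omega> \<bullet> x k \<omega>)) \<longlonglongrightarrow> 0"
      using K T unfolding stabilizing_def by blast
    then have "(\<lambda>n. expectation (\<lambda>\<omega>. x (n + d) \<omega> \<bullet> x (n + d) \<omega>)) \<longlonglongrightarrow> 0"
      by (rule LIMSEQ_ignore_initial_segment)
    also have "(\<lambda>n. expectation (\<lambda>\<omega>. x (n + d) \<omega> \<bullet> x (n + d) \<omega>))
        = (\<lambda>n. qf ((lyap K ^^ (n + d)) (\<lambda>_. mat 1) 0) x0)"
    proof
      fix n
      have "expectation (\<lambda>\<omega>. x (n + d) \<omega> \<bullet> x (n + d) \<omega>) = energy d ((lyap K ^^ n) (\<lambda>_. mat 1))"
        using mean_square_iterate[of n] by (simp add: add.commute)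
      also have "\<dots> = qf ((lyap K ^^ d) ((lyap K ^^ n) (\<lambda>_. mat 1)) 0) x0"
        by (intro energy_uncontrolled all_regular control_L2) (simp add: open_loop)
      finally show "expectation (\<lambda>\<omega>. x (n + d) \<omega> \<bullet> x (n + d) \<omega>)
          = qf ((lyap K ^^ (n + d)) (\<lambda>_. mat 1) 0) x0"
        by (simp add: add.commute[of n d] funpow_add)
    qed
    finally show "(\<lambda>k. qf ((lyap K ^^ k) (\<lambda>_. mat 1) 0) x0) \<longlonglongrightarrow> 0"
      by (rule LIMSEQ_offset)
  qed
next
  assume K: "stable K"
  show "stabilizing M w d A Abar B Bbar K"
    unfolding stabilizing_def
  proof (intro allI impI)
    fix x0 u0 and x :: "nat \<Rightarrow> 'a \<Rightarrow> real^'n" and u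
    assume T: "delay_trajectory M w d A Abar B Bbar x0 u0 x u" "predictor_feedback M w d K x u"
    interpret prob_space M using wn by (simp add: white_noise_def)
    interpret delayed_feedback M w d A Abar B Bbar Q R x "\<lambda>k. u (int k - int d)" x0 K "\<lambda>k. u0 (int k - int d)"
      by unfold_locales (use assms T in \<open>auto simp: delay_trajectory_def predictor_feedback_def\<close>)
    show "(\<lambda>k. expectation (\<lambda>\<omega>. x k \<omega> \<bullet> x k \<omega>)) \<longlonglongrightarrow> 0"
      by (rule stable_imp_mean_square_stable[OF K])
  qed
qed

lemma lyap_zero_const: "lyap 0 (\<lambda>_. Y) = (\<lambda>_. free_op Y)"
  by (simp add: fun_eq_iff lyap_def free_op_def drift_def diffusion_def)

text \<open>Along the uncontrolled trajectory from \<open>x0\<close> the output has second moment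
  \<open>qf ((free_op ^^ k) Q) x0\<close>, so it vanishes almost surely at all times. Zero input
  counts as feedback with gain 0, for which \<open>lyap\<close> on constant tuples is
  \<open>free_op\<close>.\<close>

theorem exactly_observable_imp_observable:
  fixes M :: "'a measure"
  assumes wn: "white_noise M w" and d: "1 \<le> d" and S: "is_psd_sqrt S Q"
    and obs: "exactly_observable M w A Abar S"
    and x0: "\<And>k. qf ((free_op ^^ k) Q) x0 = 0"
  shows "x0 = 0"
proof -
  interpret prob_space M using wn by (simp add: white_noise_def)
  define x where "x = state M w (\<lambda>_ _ _. 0) x0"
  have x: "x 0 = (\<lambda>_. x0)" "x (Suc k) \<omega> = (A + w k \<omega> *\<^sub>R Abar) *v x k \<omega>" for k \<omega>
    by (simp_all add: x_def)
  interpret trajectory M w d A Abar B Bbar Q R x "\<lambda>_ _. 0" x0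
    by unfold_locales (use wn d x in auto)
  have reg: "regular k" for k by (rule regularI) (rule L2_const)
  have iter: "energy (0 + k) P = energy 0 ((lyap 0 ^^ k) P)" for k P
    by (rule energy_iterate[OF reg L2_const]) simp
  have pow: "(lyap 0 ^^ k) (\<lambda>_. Q) = (\<lambda>_. (free_op ^^ k) Q)" for k
    by (induction k) (simp_all add: lyap_zero_const)
  have Sqf: "qf Q y = (norm (S *v y))\<^sup>2" for y
    using S qf_congruence[of S "mat 1" y]
    by (simp add: is_psd_sqrt_def possemidef_def qf_mat1)
  have "AE \<omega> in M. S *v x k \<omega> = 0" for k
  proof -
    have "L2 M M (x k)" using regular_x_L2[OF reg] L2_past by blast
    then have "integrable M (\<lambda>\<omega>. qf Q (x k \<omega>))" by (rule L2_qf_integrable)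
    moreover have "expectation (\<lambda>\<omega>. qf Q (x k \<omega>)) = 0"
      unfolding energy_const[OF reg] using iter[of k "\<lambda>_. Q"] by (simp add: pow energy_0 x0)
    ultimately have "AE \<omega> in M. qf Q (x k \<omega>) = 0"
      by (subst (asm) integral_nonneg_eq_0_iff_AE) (auto simp: Sqf)
    then show ?thesis by (simp add: Sqf)
  qed
  then have "AE \<omega> in M. x 0 \<omega> = 0"
    using obs[unfolded exactly_observable_def, rule_format, of x 0] x by simp
  then show ?thesis by (simp add: x AE_const)
qed

end

text \<open>The first conjunct keeps the statements about all runs of the iteration from being
  vacuous; uniqueness up to index \<open>d\<close> justifies speaking of the positive definite
  solution.\<close>

theorem theorem1:
  fixes M :: "'a measure" and w :: "nat \<Rightarrow> 'a \<Rightarrow> real" and d :: nat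
    and A Abar Q Qsqrt :: "real^'n^'n" and B Bbar :: "real^'m^'n"
    and R :: "real^'m^'m" and K0 :: "real^'n^'m"
  assumes "white_noise M w"
    and "1 \<le> d"
    and "possemidef Q"
    and "posdef R"
    and "is_psd_sqrt Qsqrt Q"
    and "exactly_observable M w A Abar Qsqrt"
    and "stabilizing M w d A Abar B Bbar K0"
  shows "(\<exists>P K. policy_iteration d A Abar B Bbar Q R K0 P K) \<and>
    (\<forall>P K. policy_iteration d A Abar B Bbar Q R K0 P K \<longrightarrow>
      (\<forall>j P'. posdef_lyapunov_solution d A Abar B Bbar Q R (K j) P' \<longrightarrow> (\<forall>i\<le>d. P' i = P j i)) \<and>
      (\<forall>j. stabilizing M w d A Abar B Bbar (K j)) \<and>
      (\<forall>j. \<forall>i\<le>d. posdef (P (Suc j) i) \<and> loewner_le (P (Suc j) i) (P j i)) \<and>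
      (\<exists>Plim Klim.
        (\<forall>i\<le>d. (\<lambda>j. P j i) \<longlonglongrightarrow> Plim i) \<and>
        K \<longlonglongrightarrow> Klim \<and>
        lyapunov_eqs d A Abar B Bbar Q R Klim Plim \<and>
        Klim = gain_of d A Abar B Bbar R Plim))"
proof -
  interpret delay_lqr d A Abar B Bbar Q R
    using assms(3,4) by unfold_locales
  interpret observable_lqr d A Abar B Bbar Q R
    by unfold_locales (rule exactly_observable_imp_observable[OF assms(1,2,5,6)])
  note iff = stabilizing_iff_stable[OF assms(1,2)]
  show ?thesis
  proof (intro conjI allI impI)
    show "\<exists>P K. policy_iteration d A Abar B Bbar Q R K0 P K"
      using policy_iteration_exists assms(7) unfolding iff .
  next
    fix P K j
    assume pi: "policy_iteration d A Abar B Bbar Q R K0 P K"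
    show "stabilizing M w d A Abar B Bbar (K j)"
      unfolding iff by (rule iterate_stable[OF pi])
    show "P' i = P j i"
      if "posdef_lyapunov_solution d A Abar B Bbar Q R (K j) P'" "i \<le> d" for P' i
      using iterate_unique[OF pi that] .
    show "posdef (P (Suc j) i)" "loewner_le (P (Suc j) i) (P j i)" if "i \<le> d" for i
      by (rule iterate_loewner[OF pi that])+
    show "\<exists>Plim Klim. (\<forall>i\<le>d. (\<lambda>j. P j i) \<longlonglongrightarrow> Plim i) \<and> K \<longlonglongrightarrow> Klim \<and>
        lyapunov_eqs d A Abar B Bbar Q R Klim Plim \<and> Klim = gain_of d A Abar B Bbar R Plim"
      by (rule iterate_limit[OF pi])
  qed
qed

end
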